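(* Let $A\in\mathbb R^{n\times n}$, $B\in\mathbb R^{n\times m}$, $C\in\mathbb R^{m\times n}$. Let $\theta\in\mathcal K_\infty$ be continuously differentiable, let $\alpha:\mathbb R_+\to\mathbb R_+$ satisfy $\alpha\le\theta$, and let $c,\mu>0$ with $c\mu\ge 1$. Define the correspondence $F:\mathbb R^m\rightrightarrows\mathbb R^m$ by $$F(y):=\big\{w\in\mathbb R^m:\ \|w\|\le\theta(\|y\|),\ \langle w,y\rangle\ge\|y\|\alpha(\|y\|),\ \text{and } c\langle w,y\rangle\ge\|w\|\ \text{if }\|y\|>\mu\big\},$$ and consider the forced Lur'e inclusion $$\dot x(t)-Ax(t)-Bv(t)\in -BF(Cx(t)),\quad t\ge 0.\qquad(\ast)$$ Assume that the pair $(C,A)$ is detectable and that there exists a symmetric positive semi-definite $P\in\mathbb R^{n\times n}$ such that $$\begin{pmatrix}A^\top P+PA & PB-C^\top\\ B^\top P-C & 0\end{pmatrix}\le 0.$$ The following statements hold. (1) If $\alpha\in\mathcal K_\infty$, then $(\ast)$ is Input-to-State Stable (ISS). Now assume that $\alpha\in\mathcal K_\infty$ admits the lower bound $\alpha(s)\ge\varepsilon_0 s$ for all $s\ge0$, for some $\varepsilon_0>0$. Then, furthermore: (2) For every $R>0$, there exist $M,\gamma>0$ such that $$\|x(t)\|\le M\big(e^{-\gamma t}\|x(0)\|+\|v\|_{L^\infty(0,t)}\big)\quad\forall\,t\ge0$$ for all trajectories $(v,x)\in\mathcal B_{\rm inc}^\infty$ with $v\in L^\infty(\mathbb R_+,\mathbb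 R^m)$ and $\|x(0)\|+\|v\|_{L^\infty}\le R$. (3) If $\theta$ is linearly bounded (i.e. there is $a>0$ with $\theta(s)\le as$ for all $s\ge0$), then $(\ast)$ is exponentially ISS. The comparison functions and constants in these conclusions depend only on $(A,B,C)$, on $\alpha,\theta,\mu,c$ and, where relevant, on $R$.
   Context: $\|\cdot\|$ is the Euclidean norm induced by $\langle\cdot,\cdot\rangle$. $\mathcal K$ is the set of continuous strictly increasing functions $\mathbb R_+\to\mathbb R_+$ vanishing at $0$; $\mathcal K_\infty$ is the set of unbounded functions in $\mathcal K$. $\mathcal{KL}$ is the set of functions $\psi:\mathbb R_+\times\mathbb R_+\to\mathbb R_+$ such that $\psi(\cdot,t)\in\mathcal K$ for each $t$, and for each $s$ the function $\psi(s,\cdot)$ is non-increasing with $\psi(s,t)\to0$ as $t\to\infty$. Matrix inequalities are in the sense of symmetric (semi-)definiteness. $(C,A)$ is detectable if there is $H$ with $A-HC$ Hurwitz (all eigenvalues have negative real part). The behaviours of $(\ast)$ are: $\mathcal B_{\rm inc}$, the set of pairs (trajectories) $(v,x)\in L^1_{\rm loc}(\mathbb R_+,\mathbb R^m)\times W^{1,1}_{\rm loc}(\mathbb R_+,\mathbb R^n)$ satisfying $(\ast)$ for almost every $t\ge0$; and $\mathcal B_{\rm inc}^\infty:=\{(v,x)\in\mathcal B_{\rm inc}: v\in L^\infty_{\rm loc}(\mathbb R_+,\mathbb R^m)\}$. $(\ast)$ is ISS if there exist $\psi\in\mathcal{KL}$, $\phi\in\mathcal K$ such that $\|x(t)\|\le\psi(\|x(0)\|,t)+\phi(\|v\|_{L^\infty(0,t)})$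 for all $t\ge0$ and all $(v,x)\in\mathcal B_{\rm inc}^\infty$. $(\ast)$ is exponentially ISS if there exist $M,\gamma>0$ such that $\|x(t)\|\le M(e^{-\gamma t}\|x(0)\|+\|v\|_{L^\infty(0,t)})$ for all $t\ge0$ and all $(v,x)\in\mathcal B_{\rm inc}^\infty$. *)

theory Defs
  imports "HOL-Analysis.Analysis" "HOL-Probability.Essential_Supremum"
begin

section \<open>Comparison functions\<close>

text \<open>Functions on the half-line \<open>\<real>\<^sub>+ = {0..}\<close>, and signals and trajectories below, are represented
  by total functions on the reals whose values at negative arguments are never used.\<close>

definition class_K :: "(real \<Rightarrow> real) set" where
  "class_K = {f. f \<in> {0..} \<rightarrow> {0..} \<and> continuous_on {0..} f \<and> strict_mono_on {0..} f \<and> f 0 = 0}"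

definition class_K_inf :: "(real \<Rightarrow> real) set" where
  "class_K_inf = {f \<in> class_K. \<not> bdd_above (f ` {0..})}"

definition class_KL :: "(real \<Rightarrow> real \<Rightarrow> real) set" where
  "class_KL = {\<psi>. (\<forall>t\<ge>0. (\<lambda>s. \<psi> s t) \<in> class_K) \<and>
                   (\<forall>s\<ge>0. antimono_on {0..} (\<psi> s) \<and> (\<psi> s \<longlongrightarrow> 0) at_top)}"

text \<open>One-sided derivative at \<open>0\<close>.\<close>
definition C1_on_half_line :: "(real \<Rightarrow> real) \<Rightarrow> bool" where
  "C1_on_half_line f \<longleftrightarrow>
     (\<exists>f'. continuous_on {0..} f' \<and>
           (\<forall>s\<ge>0. (f has_real_derivative f' s) (at s within {0..})))"

section \<open>Matrices\<close>

definition pos_semidef :: "real^'n^'n \<Rightarrow> bool" where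
  "pos_semidef M \<longleftrightarrow> transpose M = M \<and> (\<forall>x. 0 \<le> x \<bullet> (M *v x))"

definition loewner_le :: "real^'n^'n \<Rightarrow> real^'n^'n \<Rightarrow> bool" where
  "loewner_le M N \<longleftrightarrow> pos_semidef (N - M)"

definition block_matrix ::
  "real^'n^'n \<Rightarrow> real^'m^'n \<Rightarrow> real^'n^'m \<Rightarrow> real^'m^'m \<Rightarrow> real^('n + 'm)^('n + 'm)" where
  "block_matrix M11 M12 M21 M22 =
     (\<chi> i j. case i of
        Inl p \<Rightarrow> (case j of Inl q \<Rightarrow> M11 $ p $ q | Inr q \<Rightarrow> M12 $ p $ q)
      | Inr p \<Rightarrow> (case j of Inl q \<Rightarrow> M21 $ p $ q | Inr q \<Rightarrow> M22 $ p $ q))"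

definition complex_eigenvalue :: "real^'n^'n \<Rightarrow> complex \<Rightarrow> bool" where
  "complex_eigenvalue M l \<longleftrightarrow> (\<exists>z. z \<noteq> 0 \<and> map_matrix complex_of_real M *v z = l *s z)"

definition hurwitz :: "real^'n^'n \<Rightarrow> bool" where
  "hurwitz M \<longleftrightarrow> (\<forall>l. complex_eigenvalue M l \<longrightarrow> Re l < 0)"

definition detectable :: "real^'n^'m \<Rightarrow> real^'n^'n \<Rightarrow> bool" where
  "detectable C A \<longleftrightarrow> (\<exists>H :: real^'m^'n. hurwitz (A - H ** C))"

section \<open>Function spaces on the half-line\<close>

definition L1_loc :: "(real \<Rightarrow> real^'m) set" where
  "L1_loc = {v. \<forall>t\<ge>0. v absolutely_integrable_on {0..t}}"

text \<open>On a null set \<open>I\<close>, in particular on \<open>{0<..<0}\<close>, the essential supremum in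
  \<^typ>\<open>ennreal\<close> is \<open>0\<close>; the seminorm is meaningful for members of \<open>L_inf I\<close> only.\<close>
definition L_inf_norm :: "real set \<Rightarrow> (real \<Rightarrow> real^'m) \<Rightarrow> real" where
  "L_inf_norm I v = enn2real (esssup (lebesgue_on I) (\<lambda>t. ennreal (norm (v t))))"

definition L_inf :: "real set \<Rightarrow> (real \<Rightarrow> real^'m) set" where
  "L_inf I = {v. v \<in> borel_measurable (lebesgue_on I) \<and>
                 esssup (lebesgue_on I) (\<lambda>t. ennreal (norm (v t))) < \<infinity>}"

definition L_inf_loc :: "(real \<Rightarrow> real^'m) set" where
  "L_inf_loc = {v. \<forall>t\<ge>0. v \<in> L_inf {0..t}}"

text \<open>Absolute continuity in the usual epsilon-delta sense. The pieces of a division \<open>d\<close> of a set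
  are finitely many non-overlapping compact intervals \<open>k = {Inf k..Sup k}\<close>.\<close>
definition abs_continuous_on :: "real set \<Rightarrow> (real \<Rightarrow> real^'n) \<Rightarrow> bool" where
  "abs_continuous_on S f \<longleftrightarrow>
     (\<forall>\<epsilon>>0. \<exists>\<delta>>0. \<forall>d T. d division_of T \<and> T \<subseteq> S \<and> (\<Sum>k\<in>d. Sup k - Inf k) < \<delta>
        \<longrightarrow> (\<Sum>k\<in>d. norm (f (Sup k) - f (Inf k))) < \<epsilon>)"

text \<open>The elements of \<open>W\<^sup>1\<^sup>,\<^sup>1\<close> on a compact interval are, as continuous representatives,
  the absolutely continuous functions, and the weak derivative is the pointwise derivative,
  which exists almost everywhere.\<close>
definition W11_loc :: "(real \<Rightarrow> real^'n) set" where
  "W11_loc = {x. \<forall>t\<ge>0. abs_continuous_on {0..t} x}"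

section \<open>The forced Lur'e inclusion\<close>

definition lure_F ::
  "(real \<Rightarrow> real) \<Rightarrow> (real \<Rightarrow> real) \<Rightarrow> real \<Rightarrow> real \<Rightarrow> real^'m \<Rightarrow> (real^'m) set" where
  "lure_F \<alpha> \<theta> c \<mu> y =
     {w. norm w \<le> \<theta> (norm y) \<and> w \<bullet> y \<ge> norm y * \<alpha> (norm y) \<and>
         (norm y > \<mu> \<longrightarrow> c * (w \<bullet> y) \<ge> norm w)}"

definition B_inc ::
  "real^'n^'n \<Rightarrow> real^'m^'n \<Rightarrow> real^'n^'m \<Rightarrow> (real^'m \<Rightarrow> (real^'m) set)
    \<Rightarrow> ((real \<Rightarrow> real^'m) \<times> (real \<Rightarrow> real^'n)) set" where
  "B_inc A B C F =
     {(v, x). v \<in> L1_loc \<and> x \<in> W11_loc \<and>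
        (AE t in lebesgue_on {0..}. \<exists>dx.
           (x has_vector_derivative dx) (at t within {0..}) \<and>
           dx - A *v x t - B *v v t \<in> (\<lambda>w. - (B *v w)) ` F (C *v x t))}"

definition B_inc_inf ::
  "real^'n^'n \<Rightarrow> real^'m^'n \<Rightarrow> real^'n^'m \<Rightarrow> (real^'m \<Rightarrow> (real^'m) set)
    \<Rightarrow> ((real \<Rightarrow> real^'m) \<times> (real \<Rightarrow> real^'n)) set" where
  "B_inc_inf A B C F = {(v, x) \<in> B_inc A B C F. v \<in> L_inf_loc}"

definition ISS ::
  "real^'n^'n \<Rightarrow> real^'m^'n \<Rightarrow> real^'n^'m \<Rightarrow> (real^'m \<Rightarrow> (real^'m) set) \<Rightarrow> bool" where
  "ISS A B C F \<longleftrightarrow>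
     (\<exists>\<psi>\<in>class_KL. \<exists>\<phi>\<in>class_K. \<forall>(v, x)\<in>B_inc_inf A B C F. \<forall>t\<ge>0.
        norm (x t) \<le> \<psi> (norm (x 0)) t + \<phi> (L_inf_norm {0<..<t} v))"

definition exponentially_ISS ::
  "real^'n^'n \<Rightarrow> real^'m^'n \<Rightarrow> real^'n^'m \<Rightarrow> (real^'m \<Rightarrow> (real^'m) set) \<Rightarrow> bool" where
  "exponentially_ISS A B C F \<longleftrightarrow>
     (\<exists>M>0. \<exists>\<gamma>>0. \<forall>(v, x)\<in>B_inc_inf A B C F. \<forall>t\<ge>0.
        norm (x t) \<le> M * (exp (- \<gamma> * t) * norm (x 0) + L_inf_norm {0<..<t} v))"

end

theory Submission
  imports Defs "HOL-Computational_Algebra.Fundamental_Theorem_Algebra"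
begin

text \<open>The inequality for \<open>P\<close> says that \<open>x \<bullet> P x\<close> is a storage function: along trajectories its derivative
  is at most \<open>2 \<langle>y, v\<rangle> - 2 \<langle>w, y\<rangle>\<close>, where \<open>y = C x\<close> and \<open>w \<in> F y\<close>. It need not control \<open>x\<close>. Detectability gives
  a positive definite \<open>Q\<close> for which the derivative of \<open>x \<bullet> Q x\<close> is at most
  \<open>-\<bar>x\<bar>\<^sup>2 + K \<bar>x\<bar> (\<bar>y\<bar> + \<bar>w\<bar> + \<bar>v\<bar>)\<close>. For ISS one uses the Lyapunov function \<open>\<kappa> (x \<bullet> P x) + h (x \<bullet> Q x)\<close>, where
  \<open>h'\<close> decays like an inverse square root at infinity, so that \<open>h' \<bar>x\<bar> (\<bar>y\<bar> + \<bar>w\<bar>)\<close> is dominated by \<open>\<langle>w, y\<rangle>\<close> for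
  large \<open>y\<close>, and is of the order of \<open>\<alpha>\<close> near \<open>0\<close>, so that the same holds for small \<open>y\<close>. Under the
  linear lower bound on \<open>\<alpha>\<close> the quadratic function \<open>\<kappa> (x \<bullet> P x) + x \<bullet> Q x\<close> works wherever \<open>\<theta>\<close> is
  linearly bounded; for statement (2) this is the case on the bounded set to which ISS confines the
  trajectories.\<close>

section \<open>Lyapunov's theorem for Hurwitz matrices\<close>

text \<open>The obstacle is the cross term of order \<open>norm x * norm w\<close> in the derivative
  of \<open>x \<bullet> (Q *v x)\<close>, since \<open>\<theta>\<close> may grow arbitrarily fast.
  For \<open>norm y > \<mu>\<close> all that is known is linear in \<open>w \<bullet> y\<close>:
  \<open>norm w \<le> c * (w \<bullet> y)\<close> by definition of the correspondence, and
  \<open>norm y \<le> (w \<bullet> y) / \<alpha> \<mu>\<close> by monotonicity of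
  \<open>\<alpha>\<close>. This fixes the exponent of the weight. With \<open>s\<close> of the order
  of \<open>(norm x)^2\<close>, the product of \<open>h' s\<close> and \<open>sqrt s\<close> must
  stay bounded, so that the cross term becomes a constant times \<open>w \<bullet> y\<close>; but
  the product of \<open>h' s\<close> and \<open>s\<close>, which is the decay that remains, must
  tend to infinity, for otherwise large inputs could not be counterbalanced. For
  \<open>norm y \<le> \<mu>\<close> one has \<open>\<theta> s \<le> L * s\<close>, and there are two
  cases: either \<open>norm x\<close> exceeds a fixed multiple of \<open>norm y\<close> and the term
  \<open>-(norm x)^2\<close> absorbs the cross term, or it does not, and then the factor
  \<open>\<alpha>\<close> in \<open>h'\<close> turns the cross term into a multiple of
  \<open>norm y * \<alpha> (norm y)\<close>, which is at most \<open>w \<bullet> y\<close>.\<close>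

definition cx_vec :: "real^'n \<Rightarrow> real^'n \<Rightarrow> complex^'n" where
  "cx_vec a b = (\<chi> i. Complex (a $ i) (b $ i))"

lemma cx_vec_eq_0_iff: "cx_vec a b = 0 \<longleftrightarrow> a = 0 \<and> b = 0"
  by (auto simp: cx_vec_def vec_eq_iff complex_eq_iff)

lemma cx_vec_eq_iff: "cx_vec a b = cx_vec a' b' \<longleftrightarrow> a = a' \<and> b = b'"
  by (auto simp: cx_vec_def vec_eq_iff complex_eq_iff)

lemma cx_vec_add: "cx_vec a b + cx_vec a' b' = cx_vec (a + a') (b + b')"
  by (simp add: cx_vec_def vec_eq_iff complex_eq_iff)

lemma cx_vec_scale: "l *s cx_vec a b = cx_vec (Re l *\<^sub>R a - Im l *\<^sub>R b) (Im l *\<^sub>R a + Re l *\<^sub>R b)"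
  by (simp add: cx_vec_def vec_eq_iff complex_eq_iff)

lemma map_matrix_of_real_cx_vec:
  fixes M :: "real^'n^'m"
  shows "map_matrix complex_of_real M *v cx_vec a b = cx_vec (M *v a) (M *v b)"
  by (simp add: cx_vec_def vec_eq_iff complex_eq_iff matrix_vector_mult_def map_matrix_def)

text \<open>Split a linear factor \<open>X - l\<close> off the annihilating polynomial. Either the
  quotient still annihilates \<open>w\<close>, and the degree has dropped, or the quotient applied
  to \<open>w\<close> is a nonzero vector killed by \<open>M - l\<close>. Everything stays inside
  the invariant set \<open>Z\<close>, which is what locates the eigenvector.\<close>

lemma poly_annihilates_imp_eigenvector:
  fixes M :: "complex^'n^'n" and Z :: "(complex^'n) set" and p :: "complex poly"
  assumes Z0: "0 \<in> Z" and Zadd: "\<And>x y. x \<in> Z \<Longrightarrow> y \<in> Z \<Longrightarrow> x + y \<in> Z"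
    and Zscale: "\<And>l x. x \<in> Z \<Longrightarrow> l *s x \<in> Z"
    and ZM: "\<And>x. x \<in> Z \<Longrightarrow> M *v x \<in> Z" and w: "w \<in> Z" "w \<noteq> 0"
    and p: "p \<noteq> 0" "(\<Sum>i\<le>degree p. coeff p i *s (((*v) M) ^^ i) w) = 0"
  shows "\<exists>z\<in>Z. \<exists>l. z \<noteq> 0 \<and> M *v z = l *s z"
proof -
  \<comment> \<open>\<open>E p\<close> is the vector p(M) w.\<close>
  define E where "E p = (\<Sum>i\<le>degree p. coeff p i *s (((*v) M) ^^ i) w)" for p
  have E: "E p = (\<Sum>i\<le>n. coeff p i *s (((*v) M) ^^ i) w)" if "degree p \<le> n" for p n
    unfolding E_def using that
    by (intro sum.mono_neutral_left) (auto simp: coeff_eq_0)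
  have pow: "(((*v) M) ^^ i) w \<in> Z" for i
    by (induction i) (auto simp: w ZM)
  have EZ: "E p \<in> Z" for p
  proof -
    have "(\<Sum>i\<in>I. coeff p i *s (((*v) M) ^^ i) w) \<in> Z" if "finite I" for I
      using that by (induction I rule: finite_induct) (auto simp: Z0 intro!: Zadd Zscale pow)
    then show ?thesis by (simp add: E_def)
  qed
  \<comment> \<open>Multiplication by \<open>X - l\<close> acts on \<open>E\<close> as
    \<open>M - l\<close>.\<close>
  have Emul: "E ([:-l, 1:] * q) = M *v E q - l *s E q" for l q
  proof -
    let ?n = "degree q"
    have "degree ([:-l, 1:] * q) \<le> Suc ?n"
      using degree_mult_le[of "[:-l, 1:]" q] by simp
    moreover have coeff_mult: "coeff ([:-l, 1:] * q) i = coeff (pCons 0 q) i - l * coeff q i" for i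
      by simp
    ultimately have "E ([:-l, 1:] * q)
        = (\<Sum>i\<le>Suc ?n. coeff (pCons 0 q) i *s (((*v) M) ^^ i) w - (l * coeff q i) *s (((*v) M) ^^ i) w)"
      by (simp only: E[of "[:-l, 1:] * q" "Suc ?n"] coeff_mult vec.scale_left_diff_distrib)
    also have "\<dots> = (\<Sum>i\<le>?n. coeff q i *s (((*v) M) ^^ Suc i) w) - (\<Sum>i\<le>Suc ?n. (l * coeff q i) *s (((*v) M) ^^ i) w)"
      by (subst sum_subtractf, subst sum.atMost_Suc_shift) simp
    also have "(\<Sum>i\<le>?n. coeff q i *s (((*v) M) ^^ Suc i) w) = M *v E q"
      by (simp add: E_def matrix_vector_right_distrib vec.linear_sum[OF matrix_vector_mul_linear_gen] vector_scalar_commute)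
    also have "(\<Sum>i\<le>Suc ?n. (l * coeff q i) *s (((*v) M) ^^ i) w) = l *s E q"
      by (subst E[of q "Suc ?n"]) (auto simp: vec.scale_sum_right)
    finally show ?thesis .
  qed
  have "\<exists>z\<in>Z. \<exists>l. z \<noteq> 0 \<and> M *v z = l *s z" if "degree p = n" "p \<noteq> 0" "E p = 0" for n p
    using that
  proof (induction n arbitrary: p)
    case 0
    then show ?case using w by (auto simp: E_def vec_eq_iff elim!: degree_eq_zeroE)
  next
    case (Suc n)
    obtain l where "poly p l = 0"
      using fundamental_theorem_of_algebra[of p] Suc.prems constant_degree[of p] by auto
    then obtain q where q: "p = [:-l, 1:] * q"
      by (auto simp: poly_eq_0_iff_dvd elim!: dvdE)
    have "q \<noteq> 0" using q Suc.prems by auto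
    then have dq: "degree q = n" using q Suc.prems by (simp add: degree_mult_eq del: mult_pCons_left)
    show ?case
    proof (cases "E q = 0")
      case True
      then show ?thesis using Suc.IH dq \<open>q \<noteq> 0\<close> by blast
    next
      case False
      have "M *v E q = l *s E q" using Emul[of l q] q Suc.prems(3) by simp
      then show ?thesis using False EZ by blast
    qed
  qed
  then show ?thesis using p by (auto simp: E_def)
qed

text \<open>The infinitely many iterates of \<open>w\<close> under \<open>M\<close> lie in a
  finite-dimensional space, so they satisfy a linear relation; its coefficients are those of
  \<open>p\<close>.\<close>

lemma vector_poly_annihilator:
  fixes M :: "real^'n^'n" and w :: "real^'n"
  obtains p :: "real poly" where "p \<noteq> 0" "(\<Sum>i\<le>degree p. coeff p i *\<^sub>R (((*v) M) ^^ i) w) = 0"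
proof -
  define v where "v i = (((*v) M) ^^ i) w" for i
  have "\<exists>u :: nat \<Rightarrow> real. (\<exists>i. u i \<noteq> 0) \<and> finite {i. u i \<noteq> 0} \<and> (\<Sum>i\<in>{i. u i \<noteq> 0}. u i *\<^sub>R v i) = 0"
  \<comment> \<open>Linear dependence of the set \<open>range v\<close> does not see repetitions. If
    two iterates coincide, their difference is the relation; otherwise a relation in the set can be
    indexed by exponents.\<close>
  proof (cases "inj v")
    case False
    then obtain i j where ij: "i \<noteq> j" "v i = v j" by (auto simp: inj_def)
    define u :: "nat \<Rightarrow> real" where "u k = (if k = i then 1 else if k = j then -1 else 0)" for k
    have "{i. u i \<noteq> 0} = {i, j}" by (auto simp: u_def)
    then show ?thesis using ij by (intro exI[of _ u]) (auto simp: u_def)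
  next
    case True
    have "infinite (range v)" using True by (simp add: finite_image_iff)
    then have "dependent (range v)" using independent_bound by blast
    then obtain T u where T: "finite T" "T \<subseteq> range v" "(\<Sum>x\<in>T. u x *\<^sub>R x) = 0" "\<exists>x\<in>T. u x \<noteq> 0"
      by (auto simp: dependent_explicit)
    define u' where "u' i = (if v i \<in> T then u (v i) else 0)" for i
    have sub: "{i. u' i \<noteq> 0} \<subseteq> v -` T" by (auto simp: u'_def)
    have fin: "finite (v -` T)" using T(1) True by (rule finite_vimageI)
    have "(\<Sum>i\<in>{i. u' i \<noteq> 0}. u' i *\<^sub>R v i) = (\<Sum>i\<in>v -` T. u' i *\<^sub>R v i)"
      using sub fin by (intro sum.mono_neutral_left) auto
    also have "\<dots> = (\<Sum>x\<in>T. u x *\<^sub>R x)"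
    proof -
      have "(\<Sum>x\<in>T. u x *\<^sub>R x) = (\<Sum>x\<in>v ` (v -` T). u x *\<^sub>R x)" using T(2) by (simp add: image_vimage_eq Int_absorb2)
      also have "\<dots> = (\<Sum>i\<in>v -` T. u (v i) *\<^sub>R v i)"
        using True by (subst sum.reindex) (auto intro: inj_on_subset)
      finally show ?thesis by (simp add: u'_def)
    qed
    finally have "(\<Sum>i\<in>{i. u' i \<noteq> 0}. u' i *\<^sub>R v i) = 0" using T(3) by simp
    moreover have "\<exists>i. u' i \<noteq> 0" using T(2,4) by (force simp: u'_def)
    ultimately show ?thesis using finite_subset[OF sub fin] by blast
  qed
  then obtain u :: "nat \<Rightarrow> real" where u: "\<exists>i. u i \<noteq> 0" "finite {i. u i \<noteq> 0}" "(\<Sum>i\<in>{i. u i \<noteq> 0}. u i *\<^sub>R v i) = 0"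
    by blast
  define p where "p = Abs_poly u"
  have c: "coeff p = u"
    unfolding p_def using u(2) by (intro coeff_Abs_poly_If_le[THEN trans] Abs_poly_inverse) (auto simp: MOST_iff_cofinite)
  have "(\<Sum>i\<le>degree p. coeff p i *\<^sub>R v i) = (\<Sum>i\<in>{i. u i \<noteq> 0}. u i *\<^sub>R v i)"
    unfolding c by (intro sum.mono_neutral_right) (auto simp: c[symmetric] le_degree)
  moreover have "p \<noteq> 0" using c u(1) by auto
  ultimately show ?thesis using that[of p] u(3) by (simp add: v_def)
qed

text \<open>A real invariant subspace need not contain a real eigenvector, so the eigenvector is
  sought in the complexification \<open>Z\<close> of \<open>W\<close>. The real polynomial that
  annihilates \<open>w\<close>, read with complex coefficients, annihilates
  \<open>cx_vec w 0\<close>.\<close>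

lemma invariant_subspace_eigenpair:
  fixes M :: "real^'n^'n"
  assumes W: "subspace W" "w \<in> W" "w \<noteq> 0" "\<And>x. x \<in> W \<Longrightarrow> M *v x \<in> W"
  obtains a b l where "a \<in> W" "b \<in> W" "cx_vec a b \<noteq> 0"
    "map_matrix complex_of_real M *v cx_vec a b = l *s cx_vec a b"
proof -
  let ?M = "map_matrix complex_of_real M"
  define Z where "Z = {cx_vec a b |a b. a \<in> W \<and> b \<in> W}"
  obtain p :: "real poly" where p: "p \<noteq> 0" "(\<Sum>i\<le>degree p. coeff p i *\<^sub>R (((*v) M) ^^ i) w) = 0"
    by (rule vector_poly_annihilator)
  have pow: "(((*v) ?M) ^^ i) (cx_vec w 0) = cx_vec ((((*v) M) ^^ i) w) 0" for i
    by (induction i) (auto simp: map_matrix_of_real_cx_vec)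
  have sumcx: "(\<Sum>i\<in>I. cx_vec (f i) 0) = cx_vec (\<Sum>i\<in>I. f i) 0" if "finite I" for I :: "nat set" and f :: "nat \<Rightarrow> real^'n"
    using that by (induction I rule: finite_induct) (auto simp: cx_vec_add, simp add: cx_vec_eq_0_iff)
  have "(\<Sum>i\<le>degree p. of_real (coeff p i) *s cx_vec ((((*v) M) ^^ i) w) 0) = 0"
    using p(2) by (simp add: cx_vec_scale sumcx cx_vec_eq_0_iff)
  then have eq: "(\<Sum>i\<le>degree (map_poly complex_of_real p). coeff (map_poly complex_of_real p) i *s (((*v) ?M) ^^ i) (cx_vec w 0)) = 0"
    by (simp add: pow degree_map_poly coeff_map_poly)
  have "\<exists>z\<in>Z. \<exists>l. z \<noteq> 0 \<and> ?M *v z = l *s z"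
  proof (rule poly_annihilates_imp_eigenvector[OF _ _ _ _ _ _ _ eq])
    show "0 \<in> Z" unfolding Z_def using subspace_0[OF W(1)] cx_vec_eq_0_iff[of 0 0] by force
    show "x + y \<in> Z" if xy: "x \<in> Z" "y \<in> Z" for x y
    proof -
      obtain a b a' b' where "x = cx_vec a b" "y = cx_vec a' b'" "a \<in> W" "b \<in> W" "a' \<in> W" "b' \<in> W"
        using xy unfolding Z_def by blast
      then show ?thesis unfolding Z_def using W(1) cx_vec_add subspace_add by blast
    qed
    show "l *s x \<in> Z" if x: "x \<in> Z" for l x
    proof -
      obtain a b where ab: "x = cx_vec a b" "a \<in> W" "b \<in> W" using x unfolding Z_def by blast
      have "Re l *\<^sub>R a - Im l *\<^sub>R b \<in> W" "Im l *\<^sub>R a + Re l *\<^sub>R b \<in> W"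
        using ab W(1) by (auto intro: subspace_add subspace_diff subspace_scale)
      then show ?thesis unfolding Z_def ab(1) cx_vec_scale by blast
    qed
    show "?M *v x \<in> Z" if "x \<in> Z" for x
      using that W(4) map_matrix_of_real_cx_vec unfolding Z_def by blast
    show "cx_vec w 0 \<in> Z" unfolding Z_def using W(2) subspace_0[OF W(1)] by blast
    show "cx_vec w 0 \<noteq> 0" using W by (simp add: cx_vec_eq_0_iff)
    show "map_poly complex_of_real p \<noteq> 0"
      using p(1) by (auto simp: poly_eq_iff coeff_map_poly)
  qed
  then show ?thesis using that unfolding Z_def by blast
qed

section \<open>Rank-one matrices, semidefinite forms and the Lyapunov inequality\<close>

definition outer :: "real^'n \<Rightarrow> real^'m \<Rightarrow> real^'m^'n" where
  "outer x y = (\<chi> i j. x $ i * y $ j)"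

lemma outer_mult_vec: "outer x y *v z = (y \<bullet> z) *\<^sub>R x"
  by (simp add: outer_def vec_eq_iff matrix_vector_mult_def inner_vec_def sum_distrib_left mult_ac)

text \<open>The inner product of matrices is the entrywise (Frobenius) one, so linear functionals on
  matrices are themselves given by matrices, and testing one on rank-one matrices recovers its
  bilinear form.\<close>

lemma inner_outer: "S \<bullet> outer x y = x \<bullet> (S *v y)"
  by (simp add: outer_def inner_vec_def matrix_vector_mult_def sum_distrib_left mult_ac)

lemma matrix_mult_outer: "N ** outer x y = outer (N *v x) y"
  by (simp add: outer_def vec_eq_iff matrix_vector_mult_def matrix_matrix_mult_def sum_distrib_right mult.assoc)

lemma outer_mult_matrix: "outer x y ** N = outer x (transpose N *v y)"
  by (simp add: outer_def vec_eq_iff matrix_vector_mult_def matrix_matrix_mult_def transpose_def sum_distrib_left mult.assoc)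
     (simp add: mult_ac)

lemma pos_semidef_outer: "pos_semidef (outer z z)"
  by (auto simp: pos_semidef_def outer_mult_vec inner_commute) (simp add: outer_def transpose_def vec_eq_iff mult.commute)

lemma inner_transpose_mult:
  fixes M :: "real^'n^'m"
  shows "x \<bullet> (transpose M *v y) = (M *v x) \<bullet> y"
  by (subst transpose_matrix_vector, subst inner_commute, subst dot_lmul_matrix, rule inner_commute)

lemma pos_semidef_sym: "pos_semidef Q \<Longrightarrow> x \<bullet> (Q *v y) = y \<bullet> (Q *v x)"
  using inner_transpose_mult[of x Q y] by (simp add: pos_semidef_def inner_commute)

text \<open>The form is nonnegative at \<open>k *\<^sub>R x - Q *v x\<close>; expand, and bound the
  form at \<open>Q *v x\<close> by \<open>k\<close>. In particular a vector at which the form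
  vanishes lies in the kernel.\<close>

lemma pos_semidef_norm_le:
  assumes Q: "pos_semidef Q" and k: "0 < k" "\<And>z. norm (Q *v z) \<le> k * norm z"
  shows "(norm (Q *v x))\<^sup>2 \<le> k * (x \<bullet> (Q *v x))"
proof -
  define y where "y = Q *v x"
  have "y \<bullet> (Q *v y) \<le> norm y * (k * norm y)"
    using norm_cauchy_schwarz[of y "Q *v y"] k(2)[of y] by (meson mult_left_mono norm_ge_zero order_trans)
  then have yQ: "y \<bullet> (Q *v y) \<le> k * (y \<bullet> y)" by (simp add: power2_norm_eq_inner[symmetric] power2_eq_square mult_ac)
  have "0 \<le> (k *\<^sub>R x - y) \<bullet> (Q *v (k *\<^sub>R x - y))" using Q by (auto simp: pos_semidef_def)
  also have "\<dots> = k\<^sup>2 * (x \<bullet> y) - 2 * k * (y \<bullet> y) + y \<bullet> (Q *v y)"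
    using pos_semidef_sym[OF Q, of x y]
    by (simp add: matrix_vector_mult_diff_distrib matrix_vector_mult_scaleR inner_diff_left inner_diff_right
        y_def[symmetric] power2_eq_square inner_commute[of y x] algebra_simps)
  finally have "0 \<le> k * (k * (x \<bullet> y) - y \<bullet> y)" using yQ by (simp add: algebra_simps power2_eq_square)
  then show ?thesis using k(1) by (simp add: zero_le_mult_iff y_def[symmetric] power2_norm_eq_inner)
qed

text \<open>The hypothesis makes the range of \<open>S\<close> invariant under \<open>M\<close>; every eigenvalue of \<open>M\<close> on that range
  has nonnegative real part.\<close>
lemma psd_certificate_imp_not_hurwitz:
  fixes M S :: "real^'n^'n"
  assumes S: "pos_semidef S" "S \<noteq> 0" and MS: "\<And>z. 0 \<le> z \<bullet> (M *v (S *v z))"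
  shows "\<not> hurwitz M"
proof -
  note sym = pos_semidef_sym[OF S(1)]
  define W where "W = range ((*v) S)"
  have subW: "subspace W"
    unfolding W_def by (intro linear_subspace_image) auto
  \<comment> \<open>Along the line \<open>z + t *\<^sub>R x\<close> with \<open>x\<close> in the
    kernel of \<open>S\<close>, the nonnegative expression \<open>MS\<close> is affine in
    \<open>t\<close>, so its slope vanishes.\<close>
  have ker: "x \<bullet> (M *v (S *v z)) = 0" if "S *v x = 0" for x z
  proof (rule ccontr)
    assume nz: "x \<bullet> (M *v (S *v z)) \<noteq> 0"
    define t where "t = - (z \<bullet> (M *v (S *v z)) + 1) / (x \<bullet> (M *v (S *v z)))"
    have "0 \<le> (z + t *\<^sub>R x) \<bullet> (M *v (S *v (z + t *\<^sub>R x)))" by (rule MS)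
    also have "\<dots> = z \<bullet> (M *v (S *v z)) + t * (x \<bullet> (M *v (S *v z)))"
      using that by (simp add: matrix_vector_right_distrib matrix_vector_mult_scaleR inner_add_left)
    also have "\<dots> = -1" using nz by (simp add: t_def)
    finally show False by simp
  qed
  have MW: "M *v x \<in> W" if xW: "x \<in> W" for x
  proof -
    obtain z where z: "x = S *v z" using xW unfolding W_def by blast
    \<comment> \<open>The component \<open>b\<close> orthogonal to the range of the symmetric
      \<open>S\<close> lies in its kernel. By \<open>ker\<close> it is then orthogonal to
      \<open>M *v x\<close> as well, hence zero.\<close>
    obtain a b where ab: "M *v x = a + b" "a \<in> W" "\<And>w. w \<in> W \<Longrightarrow> orthogonal b w"
      using orthogonal_subspace_decomp_exists[of W "M *v x"] subW by (metis span_eq_iff)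
    have "b \<bullet> (S *v y) = 0" for y using ab(3)[of "S *v y"] by (auto simp: W_def orthogonal_def)
    then have "y \<bullet> (S *v b) = 0" for y using sym by metis
    then have "S *v b = 0" using inner_eq_zero_iff by blast
    then have "b \<bullet> (M *v x) = 0" using ker z by blast
    moreover have "b \<bullet> a = 0" using ab(2,3) by (auto simp: orthogonal_def)
    ultimately have "b = 0" using ab(1) by (simp add: inner_add_right)
    then show ?thesis using ab by simp
  qed
  obtain u where u: "S *v u \<noteq> 0" using S(2) by (metis matrix_eq matrix_vector_mult_0)
  obtain a b l where ab: "a \<in> W" "b \<in> W" "cx_vec a b \<noteq> 0"
      "map_matrix complex_of_real M *v cx_vec a b = l *s cx_vec a b"
    using invariant_subspace_eigenpair[OF subW _ u MW] unfolding W_def by (metis rangeI)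
  obtain p q where pq: "a = S *v p" "b = S *v q" using ab(1,2) unfolding W_def by blast
  have eqs: "M *v a = Re l *\<^sub>R a - Im l *\<^sub>R b" "M *v b = Im l *\<^sub>R a + Re l *\<^sub>R b"
    using ab(4) by (auto simp: map_matrix_of_real_cx_vec cx_vec_scale cx_vec_eq_iff)
  have nn: "0 \<le> p \<bullet> (S *v p)" "0 \<le> q \<bullet> (S *v q)" using S(1) by (auto simp: pos_semidef_def)
  \<comment> \<open>Adding the hypothesis at the preimages of the real and imaginary parts cancels
    the terms with \<open>Im l\<close>, by symmetry of \<open>S\<close>.\<close>
  have "0 \<le> p \<bullet> (M *v a) + q \<bullet> (M *v b)" using MS[of p] MS[of q] pq by simp
  also have "\<dots> = Re l * (p \<bullet> (S *v p) + q \<bullet> (S *v q))"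
    using sym[of p q] unfolding eqs by (simp add: pq inner_add_right inner_diff_right algebra_simps)
  finally have le: "0 \<le> Re l * (p \<bullet> (S *v p) + q \<bullet> (S *v q))" .
  obtain k where k: "0 < k" "\<And>z. norm (S *v z) \<le> k * norm z"
    using linear_bounded_pos[OF matrix_vector_mul_linear[of S]] by auto
  have ker0: "S *v x = 0" if "x \<bullet> (S *v x) = 0" for x
    using pos_semidef_norm_le[OF S(1) k, of x] that by simp
  have "0 < p \<bullet> (S *v p) + q \<bullet> (S *v q)"
  proof (rule ccontr)
    assume "\<not> ?thesis"
    then have "p \<bullet> (S *v p) = 0" "q \<bullet> (S *v q) = 0" using nn by linarith+
    then have "a = 0" "b = 0" using ker0 pq by auto
    then show False using ab(3) by (simp add: cx_vec_eq_0_iff)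
  qed
  then have "0 \<le> Re l" using le by (simp add: zero_le_mult_iff)
  then show ?thesis using ab unfolding hurwitz_def complex_eigenvalue_def by (meson not_less)
qed

lemma pos_semidef_add: "pos_semidef Q \<Longrightarrow> pos_semidef R \<Longrightarrow> pos_semidef (Q + R)"
  by (auto simp: pos_semidef_def matrix_vector_mult_add_rdistrib inner_add_right)
     (simp add: transpose_def vec_eq_iff)

lemma pos_semidef_scaleR: "pos_semidef Q \<Longrightarrow> 0 \<le> r \<Longrightarrow> pos_semidef (r *\<^sub>R Q)"
  by (auto simp: pos_semidef_def transpose_scalar scaleR_matrix_vector_assoc[symmetric])

text \<open>If there were no such \<open>Q\<close>, a hyperplane would separate the matrices \<open>-(M\<^sup>T Q + Q M)\<close> from those
  \<open>R\<close> with \<open>x \<bullet> x \<le> x \<bullet> R x\<close>; its normal is the certificate \<open>S\<close> excluded above.\<close>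
lemma hurwitz_lyapunov:
  fixes M :: "real^'n^'n"
  assumes "hurwitz M"
  obtains Q where "pos_semidef Q" "\<And>x. 2 * ((Q *v x) \<bullet> (M *v x)) \<le> - (x \<bullet> x)"
proof -
  let ?L = "\<lambda>Q. - (transpose M ** Q + Q ** M)"
  define D where "D = ?L ` {Q. pos_semidef Q}"
  define T where "T = {R :: real^'n^'n. \<forall>x. x \<bullet> x \<le> x \<bullet> (R *v x)}"
  have lin: "linear ?L"
    by (rule linearI)
       (simp_all add: vec_eq_iff matrix_matrix_mult_def
          sum.distrib sum_distrib_left algebra_simps)
  have cP: "convex {Q :: real^'n^'n. pos_semidef Q}"
    by (auto simp: convex_def intro: pos_semidef_add pos_semidef_scaleR)
  have "\<exists>R \<in> D. R \<in> T"
  proof (rule ccontr)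
    assume "\<not> ?thesis"
    then have disj: "D \<inter> T = {}" by auto
    have cD: "convex D" unfolding D_def by (rule convex_linear_image[OF lin cP])
    have cT: "convex T"
    proof (rule convexI)
      fix R S :: "real^'n^'n" and u v :: real
      assume RS: "R \<in> T" "S \<in> T" and uv: "0 \<le> u" "0 \<le> v" "u + v = 1"
      show "u *\<^sub>R R + v *\<^sub>R S \<in> T"
        unfolding T_def
      proof (clarify)
        fix x
        have "u * (x \<bullet> x) + v * (x \<bullet> x) \<le> u * (x \<bullet> (R *v x)) + v * (x \<bullet> (S *v x))"
          using RS uv by (intro add_mono mult_left_mono) (auto simp: T_def)
        then show "x \<bullet> x \<le> x \<bullet> ((u *\<^sub>R R + v *\<^sub>R S) *v x)"
          using uv by (simp add: matrix_vector_mult_add_rdistrib inner_add_right scaleR_matrix_vector_assoc[symmetric] flip: distrib_right)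
      qed
    qed
    have z0: "pos_semidef (0 :: real^'n^'n)" by (auto simp: pos_semidef_def transpose_def vec_eq_iff)
    have zD: "0 \<in> D" unfolding D_def using z0 by (force simp: image_iff)
    have idT: "mat 1 + t *\<^sub>R N \<in> T" if "\<And>x. 0 \<le> x \<bullet> (N *v x)" "0 \<le> t" for t N
      using that by (auto simp: T_def matrix_vector_mult_add_rdistrib inner_add_right scaleR_matrix_vector_assoc[symmetric])
    have TD: "T \<noteq> {}" "D \<noteq> {}" using idT[of 0 0] zD by auto
    then obtain S b where S: "S \<noteq> 0" "\<And>R. R \<in> D \<Longrightarrow> S \<bullet> R \<le> b" "\<And>R. R \<in> T \<Longrightarrow> b \<le> S \<bullet> R"
      using separating_hyperplane_sets[OF cD cT TD(2,1) disj] by blast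
    have b0: "0 \<le> b" using S(2)[OF zD] by simp
    \<comment> \<open>From \<open>mat 1\<close> the set \<open>T\<close> contains the whole ray in
      direction \<open>N\<close>, and \<open>S\<close> is bounded below on \<open>T\<close>; so
      \<open>S\<close> cannot be negative on \<open>N\<close>.\<close>
    have pos: "0 \<le> S \<bullet> N" if N: "\<And>x. 0 \<le> x \<bullet> (N *v x)" for N
    proof (rule ccontr)
      assume neg: "\<not> 0 \<le> S \<bullet> N"
      define t where "t = (\<bar>S \<bullet> mat 1\<bar> + 1) / (- (S \<bullet> N))"
      have t: "0 \<le> t" unfolding t_def using neg by (intro divide_nonneg_pos) auto
      have "0 \<le> S \<bullet> (mat 1 + t *\<^sub>R N)" using b0 S(3) idT[OF N t] by fastforce
      also have "\<dots> = S \<bullet> mat 1 - (\<bar>S \<bullet> mat 1\<bar> + 1)"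
        using neg unfolding inner_add_right inner_scaleR_right by (simp add: t_def)
      finally show False by simp
    qed
    \<comment> \<open>\<open>D\<close> is a cone on which \<open>S\<close> is bounded above, so the
      bound may be lowered to \<open>0\<close>.\<close>
    have neg: "S \<bullet> ?L Q \<le> 0" if Q: "pos_semidef Q" for Q
    proof (rule ccontr)
      assume p: "\<not> S \<bullet> ?L Q \<le> 0"
      define t where "t = (b + 1) / (S \<bullet> ?L Q)"
      have t: "0 \<le> t" using p b0 by (auto simp: t_def)
      have "?L (t *\<^sub>R Q) \<in> D" unfolding D_def using pos_semidef_scaleR[OF Q t] by blast
      then have "S \<bullet> ?L (t *\<^sub>R Q) \<le> b" by (rule S(2))
      also have "S \<bullet> ?L (t *\<^sub>R Q) = t * (S \<bullet> ?L Q)" by (simp only: linear_scale[OF lin] inner_scaleR_right)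
      also have "\<dots> = b + 1" using p by (simp add: t_def)
      finally show False by simp
    qed
    have "pos_semidef S" unfolding pos_semidef_def
    proof (intro conjI allI)
      show "0 \<le> x \<bullet> (S *v x)" for x
        using pos[of "outer x x"] by (simp add: outer_mult_vec inner_outer inner_commute)
      \<comment> \<open>An antisymmetric matrix has zero quadratic form, so \<open>pos\<close>
        applies to it and to its negative. This gives the symmetry of \<open>S\<close>.\<close>
      have "S \<bullet> (outer x y - outer y x) \<ge> 0" for x y
        by (rule pos) (simp add: matrix_vector_mult_diff_rdistrib outer_mult_vec inner_diff_right inner_commute)
      then have le: "y \<bullet> (S *v x) \<le> x \<bullet> (S *v y)" for x y by (simp add: inner_diff_right inner_outer)
      have "x \<bullet> (transpose S *v y) = x \<bullet> (S *v y)" for x y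
        using le[of x y] le[of y x] by (metis inner_transpose_mult inner_commute order_antisym)
      then have "transpose S *v y = S *v y" for y by (metis vector_eq_rdot inner_commute)
      then show "transpose S = S" by (simp add: matrix_eq)
    qed
    moreover have "0 \<le> z \<bullet> (M *v (S *v z))" for z
    proof -
      \<comment> \<open>Testing \<open>neg\<close> on rank-one matrices turns the separation into
        the hypothesis of \<open>psd_certificate_imp_not_hurwitz\<close>.\<close>
      have "0 \<le> S \<bullet> (transpose M ** outer z z + outer z z ** M)"
        using neg[OF pos_semidef_outer[of z]] by (simp add: inner_diff_right inner_add_right)
      also have "\<dots> = 2 * ((transpose M *v z) \<bullet> (S *v z))"
        using pos_semidef_sym[OF \<open>pos_semidef S\<close>, of z "transpose M *v z"]
        by (simp add: inner_add_right matrix_mult_outer outer_mult_matrix inner_outer)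
      also have "(transpose M *v z) \<bullet> (S *v z) = z \<bullet> (M *v (S *v z))"
        by (metis inner_commute inner_transpose_mult)
      finally show ?thesis by simp
    qed
    ultimately show False using psd_certificate_imp_not_hurwitz S(1) assms by blast
  qed
  then obtain Q where Q: "pos_semidef Q" "\<And>x. x \<bullet> x \<le> x \<bullet> (?L Q *v x)" by (auto simp: D_def T_def)
  have "2 * ((Q *v x) \<bullet> (M *v x)) \<le> - (x \<bullet> x)" for x
  proof -
    have "x \<bullet> ((transpose M ** Q + Q ** M) *v x) = 2 * ((Q *v x) \<bullet> (M *v x))"
      using pos_semidef_sym[OF Q(1), of x "M *v x"] inner_transpose_mult[of x M "Q *v x"]
      by (simp add: matrix_vector_mult_add_rdistrib inner_add_right inner_commute flip: matrix_vector_mul_assoc)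
    moreover have "?L Q *v x = - ((transpose M ** Q + Q ** M) *v x)"
      by (metis matrix_vector_mult_diff_rdistrib matrix_vector_mult_0 diff_0)
    ultimately show ?thesis using Q(2)[of x] by simp
  qed
  then show ?thesis using that Q by blast
qed

text \<open>Write \<open>A\<close> as the Hurwitz matrix \<open>A - H ** C\<close> plus
  \<open>H ** C\<close>, whose contribution is bounded by the output. The lower bound
  \<open>q\<close> follows from the Lyapunov inequality itself: it gives
  \<open>norm x \<le> 2 * m * norm (Q *v x)\<close>, and \<open>pos_semidef_norm_le\<close> bounds
  the square of the right-hand side by \<open>4 * m^2 * k\<close> times the form.\<close>

lemma detectable_lyapunov:
  fixes A :: "real^'n^'n" and C :: "real^'n^'m"
  assumes "detectable C A"
  obtains Q q K where "pos_semidef Q" "0 < q" "0 < K"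
    "\<And>x. q * (norm x)\<^sup>2 \<le> x \<bullet> (Q *v x)" "\<And>x. x \<bullet> (Q *v x) \<le> K * (norm x)\<^sup>2"
    "\<And>x u. 2 * ((Q *v x) \<bullet> (A *v x + u)) \<le> - (norm x)\<^sup>2 + K * norm x * (norm (C *v x) + norm u)"
proof -
  obtain H :: "real^'m^'n" where H: "hurwitz (A - H ** C)" using assms by (auto simp: detectable_def)
  obtain Q where Q: "pos_semidef Q" "\<And>x. 2 * ((Q *v x) \<bullet> ((A - H ** C) *v x)) \<le> - (x \<bullet> x)"
    using hurwitz_lyapunov[OF H] by blast
  obtain k where k: "0 < k" "\<And>z. norm (Q *v z) \<le> k * norm z"
    using linear_bounded_pos[OF matrix_vector_mul_linear[of Q]] by auto
  obtain h where h: "0 < h" "\<And>z. norm (H *v z) \<le> h * norm z"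
    using linear_bounded_pos[OF matrix_vector_mul_linear[of H]] by auto
  obtain m where m: "0 < m" "\<And>z. norm ((A - H ** C) *v z) \<le> m * norm z"
    using linear_bounded_pos[OF matrix_vector_mul_linear[of "A - H ** C"]] by auto
  define K where "K = k + 2 * k * (h + 1)"
  show ?thesis
  proof (rule that[of Q "1 / (4 * m\<^sup>2 * k)" K])
    show "0 < 1 / (4 * m\<^sup>2 * k)" "0 < K" using m k h by (auto simp: K_def add_pos_pos)
    fix x
    have "(norm x)\<^sup>2 \<le> 2 * - ((Q *v x) \<bullet> ((A - H ** C) *v x))" using Q(2)[of x] by (simp add: power2_norm_eq_inner)
    also have "\<dots> \<le> 2 * (norm (Q *v x) * norm ((A - H ** C) *v x))"
      using Cauchy_Schwarz_ineq2[of "Q *v x" "(A - H ** C) *v x"] by linarith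
    also have "\<dots> \<le> 2 * (norm (Q *v x) * (m * norm x))"
      using m(2)[of x] by (intro mult_left_mono) auto
    finally have "norm x * norm x \<le> norm x * (2 * m * norm (Q *v x))" by (simp add: power2_eq_square mult_ac)
    then have "norm x \<le> 2 * m * norm (Q *v x)" by (cases "x = 0") auto
    then have "(norm x)\<^sup>2 \<le> (2 * m * norm (Q *v x))\<^sup>2" by (intro power_mono) auto
    also have "\<dots> = 4 * m\<^sup>2 * (norm (Q *v x))\<^sup>2" by (simp add: power_mult_distrib)
    also have "\<dots> \<le> 4 * m\<^sup>2 * (k * (x \<bullet> (Q *v x)))" using pos_semidef_norm_le[OF Q(1) k] by (intro mult_left_mono) auto
    finally show "1 / (4 * m\<^sup>2 * k) * (norm x)\<^sup>2 \<le> x \<bullet> (Q *v x)" using m k by (simp add: field_simps)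
    have "x \<bullet> (Q *v x) \<le> norm x * (k * norm x)"
      using norm_cauchy_schwarz[of x "Q *v x"] k(2)[of x] by (meson mult_left_mono norm_ge_zero order_trans)
    also have "\<dots> \<le> K * (norm x)\<^sup>2"
      using k h by (auto simp: K_def power2_eq_square algebra_simps)
    finally show "x \<bullet> (Q *v x) \<le> K * (norm x)\<^sup>2" .
    fix u
    have "A *v x + u = (A - H ** C) *v x + (H *v (C *v x) + u)"
      by (simp add: matrix_vector_mult_diff_rdistrib matrix_vector_mul_assoc)
    then have "2 * ((Q *v x) \<bullet> (A *v x + u)) = 2 * ((Q *v x) \<bullet> ((A - H ** C) *v x)) + 2 * ((Q *v x) \<bullet> (H *v (C *v x) + u))"
      by (simp add: inner_add_right)
    also have "\<dots> \<le> - (norm x)\<^sup>2 + 2 * (norm (Q *v x) * norm (H *v (C *v x) + u))"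
      using Q(2)[of x] norm_cauchy_schwarz[of "Q *v x" "H *v (C *v x) + u"] by (simp add: power2_norm_eq_inner)
    also have "norm (Q *v x) * norm (H *v (C *v x) + u) \<le> (k * norm x) * ((h + 1) * (norm (C *v x) + norm u))"
    proof (intro mult_mono)
      have "norm (H *v (C *v x) + u) \<le> h * norm (C *v x) + norm u"
        using norm_triangle_ineq[of "H *v (C *v x)" u] h(2)[of "C *v x"] by linarith
      also have "\<dots> \<le> (h + 1) * (norm (C *v x) + norm u)" using h(1) by (simp add: algebra_simps)
      finally show "norm (H *v (C *v x) + u) \<le> (h + 1) * (norm (C *v x) + norm u)" .
    qed (use k in auto)
    also have "2 * ((k * norm x) * ((h + 1) * (norm (C *v x) + norm u))) \<le> K * norm x * (norm (C *v x) + norm u)"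
    proof -
      have "2 * k * (h + 1) * (norm x * (norm (C *v x) + norm u)) \<le> K * (norm x * (norm (C *v x) + norm u))"
        using k by (intro mult_right_mono) (auto simp: K_def)
      then show ?thesis by (simp only: mult_ac)
    qed
    finally show "2 * ((Q *v x) \<bullet> (A *v x + u)) \<le> - (norm x)\<^sup>2 + K * norm x * (norm (C *v x) + norm u)" by simp
  qed (rule Q)
qed

section \<open>The block matrix inequality as two statements about vectors\<close>

definition join_vec :: "real^'n \<Rightarrow> real^'m \<Rightarrow> real^('n + 'm)" where
  "join_vec x u = (\<chi> i. case i of Inl p \<Rightarrow> x $ p | Inr q \<Rightarrow> u $ q)"

lemma sum_UNIV_Plus:
  fixes f :: "'a::finite + 'b::finite \<Rightarrow> real"
  shows "sum f UNIV = (\<Sum>i\<in>UNIV. f (Inl i)) + (\<Sum>i\<in>UNIV. f (Inr i))"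
  by (subst UNIV_Plus_UNIV[symmetric], subst sum.Plus) auto

lemma block_matrix_mult_join_vec:
  "block_matrix M11 M12 M21 M22 *v join_vec x u
     = join_vec (M11 *v x + M12 *v u) (M21 *v x + M22 *v u)"
  by (auto simp: vec_eq_iff block_matrix_def join_vec_def matrix_vector_mult_def sum_UNIV_Plus split: sum.split)

lemma inner_join_vec: "join_vec x u \<bullet> join_vec y w = x \<bullet> y + u \<bullet> w"
  by (simp add: inner_vec_def join_vec_def sum_UNIV_Plus)

text \<open>Since the lower right block is zero, the quadratic form at \<open>join_vec x u\<close>
  is affine in \<open>u\<close>. Being bounded above, it has no linear part, which is the second
  claim; at \<open>u = 0\<close> it gives the first.\<close>

lemma passivity_lmi:
  fixes A P :: "real^'n^'n" and B :: "real^'m^'n" and C :: "real^'n^'m"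
  assumes P: "pos_semidef P" and lmi: "loewner_le
      (block_matrix (transpose A ** P + P ** A) (P ** B - transpose C) (transpose B ** P - C) 0) 0"
  shows "(P *v x) \<bullet> (A *v x) \<le> 0" and "(P *v x) \<bullet> (B *v u) = u \<bullet> (C *v x)"
proof -
  let ?N = "block_matrix (transpose A ** P + P ** A) (P ** B - transpose C) (transpose B ** P - C) 0"
  have le: "(P *v x) \<bullet> (A *v x) + ((P *v x) \<bullet> (B *v u) - u \<bullet> (C *v x)) \<le> 0" for u
  proof -
    have "0 \<le> join_vec x u \<bullet> ((0 - ?N) *v join_vec x u)"
      using lmi by (simp only: loewner_le_def pos_semidef_def)
    then have "join_vec x u \<bullet> (?N *v join_vec x u) \<le> 0"
      by (simp only: matrix_vector_mult_diff_rdistrib inner_diff_right) simp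
    moreover have "x \<bullet> (transpose A *v (P *v x)) = (A *v x) \<bullet> (P *v x)" by (rule inner_transpose_mult)
    moreover have "u \<bullet> (transpose B *v (P *v x)) = (B *v u) \<bullet> (P *v x)" by (rule inner_transpose_mult)
    moreover have "x \<bullet> (transpose C *v u) = (C *v x) \<bullet> u" by (rule inner_transpose_mult)
    moreover have "x \<bullet> (P *v (A *v x)) = (A *v x) \<bullet> (P *v x)" "x \<bullet> (P *v (B *v u)) = (B *v u) \<bullet> (P *v x)"
      by (rule pos_semidef_sym[OF P])+
    ultimately show ?thesis
      by (simp only: block_matrix_mult_join_vec inner_join_vec matrix_vector_mult_diff_rdistrib
          matrix_vector_mult_add_rdistrib inner_add_right inner_diff_right matrix_vector_mul_assoc[symmetric])
         (simp add: inner_commute)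
  qed
  show "(P *v x) \<bullet> (A *v x) \<le> 0" using le[of 0] by simp
  define g where "g u = (P *v x) \<bullet> (B *v u) - u \<bullet> (C *v x)" for u
  have gs: "g (r *\<^sub>R u) = r * g u" for r u
    by (simp add: g_def matrix_vector_mult_scaleR algebra_simps)
  define a where "a = (P *v x) \<bullet> (A *v x)"
  have "g u = 0"
  proof (rule ccontr)
    assume "g u \<noteq> 0"
    \<comment> \<open>The scaling of \<open>u\<close> makes \<open>a + g\<close> equal to
      \<open>1\<close>, against \<open>le\<close>.\<close>
    then have "g (((1 - a) / g u) *\<^sub>R u) = 1 - a" by (simp add: gs)
    then show False using le[of "((1 - a) / g u) *\<^sub>R u"] by (simp add: g_def a_def)
  qed
  then show "(P *v x) \<bullet> (B *v u) = u \<bullet> (C *v x)" by (simp add: g_def)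
qed

section \<open>Absolutely continuous functions\<close>

text \<open>\<^const>\<open>abs_continuous_on\<close> is restricted to vector-valued functions; Lyapunov functions along
  trajectories are real-valued.\<close>
definition abs_cont_on :: "real set \<Rightarrow> (real \<Rightarrow> 'a::real_normed_vector) \<Rightarrow> bool" where
  "abs_cont_on S f \<longleftrightarrow>
     (\<forall>\<epsilon>>0. \<exists>\<delta>>0. \<forall>d T. d division_of T \<and> T \<subseteq> S \<and> (\<Sum>k\<in>d. Sup k - Inf k) < \<delta>
        \<longrightarrow> (\<Sum>k\<in>d. norm (f (Sup k) - f (Inf k))) < \<epsilon>)"

lemma abs_continuous_on_eq: "abs_continuous_on S f \<longleftrightarrow> abs_cont_on S f"
  by (simp add: abs_continuous_on_def abs_cont_on_def)

lemma abs_cont_on_subset: "abs_cont_on S f \<Longrightarrow> T \<subseteq> S \<Longrightarrow> abs_cont_on T f"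
  unfolding abs_cont_on_def by (meson order_trans)

lemma division_interval_endpoints:
  fixes T :: "real set"
  assumes "d division_of T" "k \<in> d"
  obtains u v where "k = {u..v}" "u \<le> v" "u \<in> T" "v \<in> T" "Inf k = u" "Sup k = v"
proof -
  obtain u v where k: "k = cbox u v" using division_ofD(4)[OF assms] by auto
  moreover have "k \<noteq> {}" "k \<subseteq> T" using division_ofD(2,3)[OF assms] by auto
  ultimately have "u \<le> v" "u \<in> T" "v \<in> T" by (auto simp: box_real)
  then show ?thesis using k that[of u v] by (simp add: box_real)
qed

text \<open>A single closure property that serves for linear combinations, for products of bounded
  functions and for compositions with Lipschitz functions: only increments are compared. Together
  with \<open>abs_cont_on_ident\<close> it also admits explicit smooth factors in time.\<close>

lemma abs_cont_on_dominated:
  fixes h :: "real \<Rightarrow> 'a::real_normed_vector" and f :: "real \<Rightarrow> 'b::real_normed_vector"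
    and g :: "real \<Rightarrow> 'c::real_normed_vector"
  assumes f: "abs_cont_on S f" and g: "abs_cont_on S g"
    and le: "\<And>s t. s \<in> S \<Longrightarrow> t \<in> S \<Longrightarrow> norm (h s - h t) \<le> L * norm (f s - f t) + M * norm (g s - g t)"
  shows "abs_cont_on S h"
  unfolding abs_cont_on_def
proof (intro allI impI)
  fix e :: real assume e: "0 < e"
  define K where "K = \<bar>L\<bar> + \<bar>M\<bar> + 1"
  have K: "0 < K" "L \<le> K" "M \<le> K" by (auto simp: K_def)
  have e': "0 < e / (2 * K)" using e K by simp
  obtain \<delta>1 where d1: "0 < \<delta>1" "\<And>d T. d division_of T \<Longrightarrow> T \<subseteq> S \<Longrightarrow> (\<Sum>k\<in>d. Sup k - Inf k) < \<delta>1
      \<Longrightarrow> (\<Sum>k\<in>d. norm (f (Sup k) - f (Inf k))) < e / (2 * K)"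
    using f e' unfolding abs_cont_on_def by meson
  obtain \<delta>2 where d2: "0 < \<delta>2" "\<And>d T. d division_of T \<Longrightarrow> T \<subseteq> S \<Longrightarrow> (\<Sum>k\<in>d. Sup k - Inf k) < \<delta>2
      \<Longrightarrow> (\<Sum>k\<in>d. norm (g (Sup k) - g (Inf k))) < e / (2 * K)"
    using g e' unfolding abs_cont_on_def by meson
  show "\<exists>\<delta>>0. \<forall>d T. d division_of T \<and> T \<subseteq> S \<and> (\<Sum>k\<in>d. Sup k - Inf k) < \<delta>
        \<longrightarrow> (\<Sum>k\<in>d. norm (h (Sup k) - h (Inf k))) < e"
  proof (intro exI[of _ "min \<delta>1 \<delta>2"] conjI allI impI)
    show "0 < min \<delta>1 \<delta>2" using d1 d2 by simp
    fix d T assume dT: "d division_of T \<and> T \<subseteq> S \<and> (\<Sum>k\<in>d. Sup k - Inf k) < min \<delta>1 \<delta>2"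
    then have fg: "(\<Sum>k\<in>d. norm (f (Sup k) - f (Inf k))) < e / (2 * K)" "(\<Sum>k\<in>d. norm (g (Sup k) - g (Inf k))) < e / (2 * K)"
      using d1(2)[of d T] d2(2)[of d T] by auto
    have "(\<Sum>k\<in>d. norm (h (Sup k) - h (Inf k)))
        \<le> (\<Sum>k\<in>d. K * (norm (f (Sup k) - f (Inf k)) + norm (g (Sup k) - g (Inf k))))"
    proof (rule sum_mono)
      fix k assume k: "k \<in> d"
      obtain u v where uv: "u \<in> T" "v \<in> T" "Inf k = u" "Sup k = v"
        using division_interval_endpoints[OF conjunct1[OF dT] k] by blast
      have "norm (h v - h u) \<le> L * norm (f v - f u) + M * norm (g v - g u)"
        using uv dT by (intro le) auto
      also have "\<dots> \<le> K * norm (f v - f u) + K * norm (g v - g u)"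
        using K by (intro add_mono mult_right_mono) auto
      finally show "norm (h (Sup k) - h (Inf k)) \<le> K * (norm (f (Sup k) - f (Inf k)) + norm (g (Sup k) - g (Inf k)))"
        by (simp add: uv distrib_left)
    qed
    also have "\<dots> = K * (\<Sum>k\<in>d. norm (f (Sup k) - f (Inf k))) + K * (\<Sum>k\<in>d. norm (g (Sup k) - g (Inf k)))"
      by (simp add: sum_distrib_left[symmetric] sum.distrib distrib_left)
    also have "\<dots> < K * (e / (2 * K)) + K * (e / (2 * K))"
      using fg K by (intro add_strict_mono mult_strict_left_mono) auto
    also have "\<dots> = e" using K by simp
    finally show "(\<Sum>k\<in>d. norm (h (Sup k) - h (Inf k))) < e" .
  qed
qed

lemma abs_cont_on_ident: "abs_cont_on S (\<lambda>t::real. t)"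
  unfolding abs_cont_on_def
proof (intro allI impI)
  fix e :: real assume "0 < e"
  have "(\<Sum>k\<in>d. norm (Sup k - Inf k)) = (\<Sum>k\<in>d. Sup k - Inf k)" if dT: "d division_of T" for d and T :: "real set"
  proof (rule sum.cong)
    fix k assume k: "k \<in> d"
    obtain u v where "u \<le> v" "Inf k = u" "Sup k = v" using division_interval_endpoints[OF dT k] by blast
    then show "norm (Sup k - Inf k) = Sup k - Inf k" by simp
  qed simp
  then show "\<exists>\<delta>>0. \<forall>d T. d division_of T \<and> T \<subseteq> S \<and> (\<Sum>k\<in>d. Sup k - Inf k) < \<delta>
        \<longrightarrow> (\<Sum>k\<in>d. norm (Sup k - Inf k)) < e"
    using \<open>0 < e\<close> by (intro exI[of _ e]) auto
qed

lemma abs_cont_on_imp_continuous_on: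
  assumes f: "abs_cont_on {a..b} f"
  shows "continuous_on {a..b} f"
  unfolding continuous_on_iff
proof (intro ballI allI impI)
  fix s e :: real assume s: "s \<in> {a..b}" and "0 < e"
  then obtain \<delta> where d: "0 < \<delta>" "\<And>d T. d division_of T \<Longrightarrow> T \<subseteq> {a..b} \<Longrightarrow> (\<Sum>k\<in>d. Sup k - Inf k) < \<delta>
      \<Longrightarrow> (\<Sum>k\<in>d. norm (f (Sup k) - f (Inf k))) < e"
    using f unfolding abs_cont_on_def by meson
  have *: "norm (f v - f u) < e" if "u \<le> v" "u \<in> {a..b}" "v \<in> {a..b}" "v - u < \<delta>" for u v
  proof -
    have "{{u..v}} division_of {u..v}" using that(1) by (metis atLeastatMost_empty_iff2 box_real(2) division_of_self leD)
    then show ?thesis using d(2)[of "{{u..v}}" "{u..v}"] that by auto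
  qed
  have "dist (f t) (f s) < e" if "t \<in> {a..b}" "dist t s < \<delta>" for t
    using *[of s t] *[of t s] that s by (cases "s \<le> t") (auto simp: dist_norm norm_minus_commute)
  then show "\<exists>\<delta>>0. \<forall>t\<in>{a..b}. dist t s < \<delta> \<longrightarrow> dist (f t) (f s) < e" using d(1) by blast
qed

text \<open>A tagged division is chosen so fine that the pieces tagged in \<open>N\<close> lie in an open set of measure
  less than \<open>\<delta>\<close> and are controlled by absolute continuity, the others by the derivative.\<close>
lemma abs_cont_on_nonpos_deriv_imp_le:
  fixes f :: "real \<Rightarrow> real"
  assumes ab: "a \<le> b" and f: "abs_cont_on {a..b} f" and N: "negligible N"
    and deriv: "\<And>t. t \<in> {a..b} - N \<Longrightarrow> \<exists>D\<le>0. (f has_real_derivative D) (at t within {a..b})"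
  shows "f b \<le> f a"
proof -
  have "f b - f a \<le> e * (b - a) + e" if e: "0 < e" for e
  proof -
    obtain \<delta> where d: "0 < \<delta>" "\<And>d T. d division_of T \<Longrightarrow> T \<subseteq> {a..b} \<Longrightarrow> (\<Sum>k\<in>d. Sup k - Inf k) < \<delta>
        \<Longrightarrow> (\<Sum>k\<in>d. norm (f (Sup k) - f (Inf k))) < e"
      using f e unfolding abs_cont_on_def by meson
    have Nn: "N \<in> null_sets lebesgue" using N by (simp add: negligible_iff_null_sets)
    obtain U where U: "open U" "N \<subseteq> U" "emeasure lebesgue (U - N) < ennreal \<delta>"
      using sets_lebesgue_outer_open[OF null_setsD2[OF Nn] d(1)] by blast
    have Us: "U \<in> sets lebesgue" using U(1) by (simp add: borel_open)
    have em: "emeasure lebesgue U < ennreal \<delta>" using emeasure_Diff_null_set[OF Nn Us] U(3) by simp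
    then have mU: "U \<in> lmeasurable" using Us less_trans[OF em ennreal_less_top] by (intro fmeasurableI) auto
    have Um: "measure lebesgue U < \<delta>"
      using em d(1) by (simp add: emeasure_eq_measure2[OF mU] ennreal_less_iff)
    \<comment> \<open>The straddle estimate: a derivative at \<open>t\<close> controls the increment
      over every short interval that contains \<open>t\<close>, even if \<open>t\<close> is not an
      endpoint.\<close>
    have "\<exists>r>0. t \<in> {a..b} - N \<longrightarrow> (\<forall>u v. u \<in> {a..b} \<longrightarrow> v \<in> {a..b} \<longrightarrow> u \<le> t \<longrightarrow> t \<le> v \<longrightarrow> \<bar>u - t\<bar> < r \<longrightarrow> \<bar>v - t\<bar> < r
        \<longrightarrow> f v - f u \<le> e * (v - u))" for t
    proof (cases "t \<in> {a..b} - N")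
      case True
      then obtain D where D: "D \<le> 0" "(f has_real_derivative D) (at t within {a..b})" using deriv by blast
      then obtain r where r: "0 < r" "\<And>s. s \<in> {a..b} \<Longrightarrow> \<bar>s - t\<bar> < r \<Longrightarrow> \<bar>f s - f t - D * (s - t)\<bar> \<le> e * \<bar>s - t\<bar>"
        using e unfolding has_field_derivative_def has_derivative_within_alt real_norm_def by meson
      have "f v - f u \<le> e * (v - u)"
        if "u \<in> {a..b}" "v \<in> {a..b}" "u \<le> t" "t \<le> v" "\<bar>u - t\<bar> < r" "\<bar>v - t\<bar> < r" for u v
      proof -
        have "f v - f t \<le> e * (v - t) + D * (v - t)" using r(2)[of v] that by auto
        moreover have "f t - f u \<le> e * (t - u) + D * (t - u)" using r(2)[of u] that by (auto simp: algebra_simps)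
        ultimately have "f v - f u \<le> e * (v - u) + D * (v - u)" by (simp add: algebra_simps)
        moreover have "D * (v - u) \<le> 0" using D(1) that by (intro mult_nonpos_nonneg) auto
        ultimately show ?thesis by linarith
      qed
      then show ?thesis using r(1) by blast
    qed (auto intro: exI[of _ 1])
    then obtain r where r: "\<And>t. 0 < r t" "\<And>t u v. \<lbrakk>t \<in> {a..b} - N; u \<in> {a..b}; v \<in> {a..b}; u \<le> t; t \<le> v; \<bar>u - t\<bar> < r t; \<bar>v - t\<bar> < r t\<rbrakk>
        \<Longrightarrow> f v - f u \<le> e * (v - u)"
      by metis
    define g where "g t = (if t \<in> N then U else ball t (r t))" for t
    have "gauge g" using r(1) U by (auto simp: g_def gauge_def)
    then obtain p where p: "p tagged_division_of {a..b}" "g fine p" by (rule fine_division_exists_real)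
    define q where "q = {tk \<in> p. fst tk \<in> N}"
    have fin: "finite p" using p(1) by (rule tagged_division_of_finite)
    have part: "q tagged_partial_division_of {a..b}"
      using p(1) by (auto simp: tagged_division_of_def q_def intro: tagged_partial_division_subset)
    have qt: "q tagged_division_of \<Union>(snd ` q)" by (rule tagged_partial_division_of_Union_self[OF part])
    have qd: "(snd ` q) division_of \<Union>(snd ` q)" by (rule division_of_tagged_division[OF qt])
    have ivl: "\<exists>u v. K = {u..v} \<and> u \<le> t \<and> t \<le> v \<and> u \<in> {a..b} \<and> v \<in> {a..b} \<and> Inf K = u \<and> Sup K = v"
      if tK: "(t, K) \<in> p" for t K
    proof -
      obtain u v where "K = cbox u v" using tagged_division_ofD(4)[OF p(1) tK] by blast
      moreover have "t \<in> K" "K \<subseteq> {a..b}" using tagged_division_ofD(2,3)[OF p(1) tK] by auto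
      ultimately show ?thesis by (auto simp: box_real intro!: exI[of _ u] exI[of _ v])
    qed
    have sub: "\<Union>(snd ` q) \<subseteq> {a..b}" 
    proof (rule Union_least)
      fix K assume "K \<in> snd ` q"
      then obtain t where "(t, K) \<in> p" by (auto simp: q_def)
      then show "K \<subseteq> {a..b}" by (rule tagged_division_ofD(3)[OF p(1)])
    qed
    have "\<Union>(snd ` q) \<subseteq> U"
    proof -
      have "K \<subseteq> U" if "(t, K) \<in> p" "t \<in> N" for t K
        using fineD[OF p(2) that(1)] that(2) by (simp add: g_def)
      then show ?thesis by (force simp: q_def)
    qed
    then have "measure lebesgue (\<Union>(snd ` q)) < \<delta>"
      using Um measure_mono_fmeasurable[OF _ fmeasurableD[OF lmeasurable_division[OF qd]] mU] by fastforce
    also have "measure lebesgue (\<Union>(snd ` q)) = (\<Sum>K\<in>snd ` q. Sup K - Inf K)"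
      unfolding content_division[OF qd, symmetric]
    proof (rule sum.cong)
      fix K assume K: "K \<in> snd ` q"
      obtain u v where "K = {u..v}" "u \<le> v" "Inf K = u" "Sup K = v"
        using division_interval_endpoints[OF qd K] by blast
      then show "measure lebesgue K = Sup K - Inf K" by simp
    qed simp
    finally have "(\<Sum>K\<in>snd ` q. norm (f (Sup K) - f (Inf K))) < e" using d(2)[OF qd sub] by blast
    moreover have "(\<Sum>(t,K)\<in>q. norm (f (Sup K) - f (Inf K))) = (\<Sum>K\<in>snd ` q. norm (f (Sup K) - f (Inf K)))"
    proof -
      \<comment> \<open>\<open>Inf\<close> and \<open>Sup\<close> of the empty set carry no
        information; with the value \<open>0\<close> there, \<open>D\<close> vanishes on all
        intervals with empty interior, as needed to pass from tagged pieces to the set of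
        pieces.\<close>
      define D where "D K = (if K = {} then 0 else norm (f (Sup K) - f (Inf K)))" for K
      have ne: "K \<noteq> {}" if "(t, K) \<in> q" for t K
        using tagged_division_ofD(2)[OF qt that] by blast
      have "(\<Sum>(t,K)\<in>q. D K) = sum D (snd ` q)"
      proof (rule sum.over_tagged_division_lemma[OF qt])
        fix u v :: real assume "box u v = {}"
        then have "v \<le> u" by (simp add: box_real)
        then show "D (cbox u v) = 0" by (cases "u = v") (auto simp: D_def box_real)
      qed
      moreover have "(\<Sum>(t,K)\<in>q. D K) = (\<Sum>(t,K)\<in>q. norm (f (Sup K) - f (Inf K)))"
        using ne by (intro sum.cong) (auto simp: D_def)
      moreover have "sum D (snd ` q) = (\<Sum>K\<in>snd ` q. norm (f (Sup K) - f (Inf K)))"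
        using ne by (intro sum.cong) (auto simp: D_def)
      ultimately show ?thesis by simp
    qed
    moreover have "(\<Sum>(t,K)\<in>q. f (Sup K) - f (Inf K)) \<le> (\<Sum>(t,K)\<in>q. norm (f (Sup K) - f (Inf K)))"
      by (rule sum_mono) auto
    ultimately have bad: "(\<Sum>(t,K)\<in>q. f (Sup K) - f (Inf K)) \<le> e" by linarith
    have "(\<Sum>(t,K)\<in>p - q. f (Sup K) - f (Inf K)) \<le> (\<Sum>(t,K)\<in>p - q. e * (Sup K - Inf K))"
    proof (rule sum_mono, clarify)
      fix t K assume tK: "(t, K) \<in> p" "(t, K) \<notin> q"
      obtain u v where uv: "K = {u..v}" "u \<le> t" "t \<le> v" "u \<in> {a..b}" "v \<in> {a..b}" "Inf K = u" "Sup K = v"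
        using ivl[OF tK(1)] by blast
      have tN: "t \<notin> N" using tK by (auto simp: q_def)
      have "K \<subseteq> ball t (r t)" using fineD[OF p(2) tK(1)] tN by (simp add: g_def)
      moreover have "u \<in> K" "v \<in> K" using uv by auto
      ultimately have "\<bar>u - t\<bar> < r t" "\<bar>v - t\<bar> < r t" by (auto simp: dist_real_def abs_minus_commute subset_iff)
      then show "f (Sup K) - f (Inf K) \<le> e * (Sup K - Inf K)"
        using r(2)[of t u v] uv tN by auto
    qed
    also have "\<dots> \<le> (\<Sum>(t,K)\<in>p. e * (Sup K - Inf K))"
    proof (rule sum_mono2[OF fin])
      fix tk assume "tk \<in> p - (p - q)"
      then show "0 \<le> (case tk of (t, K) \<Rightarrow> e * (Sup K - Inf K))" using ivl e by (cases tk) fastforce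
    qed auto
    also have "\<dots> = e * (\<Sum>(t,K)\<in>p. Sup K - Inf K)" by (simp add: sum_distrib_left case_prod_unfold)
    also have "(\<Sum>(t,K)\<in>p. Sup K - Inf K) = b - a" using additive_tagged_division_1[OF ab p(1), of "\<lambda>t. t"] by simp
    finally have good: "(\<Sum>(t,K)\<in>p - q. f (Sup K) - f (Inf K)) \<le> e * (b - a)" .
    have "f b - f a = (\<Sum>(t,K)\<in>p. f (Sup K) - f (Inf K))" using additive_tagged_division_1[OF ab p(1), of f] by simp
    also have "\<dots> = (\<Sum>(t,K)\<in>p - q. f (Sup K) - f (Inf K)) + (\<Sum>(t,K)\<in>q. f (Sup K) - f (Inf K))"
      using fin by (intro sum.subset_diff) (auto simp: q_def)
    finally show ?thesis using good bad by linarith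
  qed
  then have "f b - f a \<le> e" if "0 < e" for e
  proof -
    \<comment> \<open>The total error \<open>e * (b - a) + e\<close> is rescaled to exactly
      \<open>e\<close>.\<close>
    have "f b - f a \<le> e / (b - a + 1) * (b - a) + e / (b - a + 1)"
      using \<open>0 < e\<close> ab by (intro \<open>\<And>e. 0 < e \<Longrightarrow> f b - f a \<le> e * (b - a) + e\<close>) simp
    also have "\<dots> = e / (b - a + 1) * (b - a + 1)" by (simp only: distrib_left mult_1_right)
    also have "\<dots> = e" using ab by simp
    finally show ?thesis .
  qed
  then show ?thesis using field_le_epsilon[of "f b" "f a"] by (smt (verit))
qed

section \<open>Comparison functions and differential inequalities\<close>

lemma class_KI:
  assumes "continuous_on {0..} f" "\<And>s t. 0 \<le> s \<Longrightarrow> s < t \<Longrightarrow> f s < f t" "f 0 = 0"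
  shows "f \<in> class_K"
proof -
  have "0 \<le> f s" if "0 \<le> s" for s
    using assms(2)[of 0 s] assms(3) that by (cases "s = 0") auto
  then show ?thesis using assms by (auto simp: class_K_def strict_mono_on_def)
qed

lemma
  assumes "f \<in> class_K"
  shows class_K_continuous: "continuous_on {0..} f"
    and class_K_strict: "\<And>s t. 0 \<le> s \<Longrightarrow> s < t \<Longrightarrow> f s < f t"
    and class_K_0: "f 0 = 0"
    and class_K_nonneg: "\<And>s. 0 \<le> s \<Longrightarrow> 0 \<le> f s"
    and class_K_mono: "\<And>s t. 0 \<le> s \<Longrightarrow> s \<le> t \<Longrightarrow> f s \<le> f t"
    and class_K_pos: "\<And>s. 0 < s \<Longrightarrow> 0 < f s"
proof -
  show st: "f s < f t" if "0 \<le> s" "s < t" for s t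
    using assms that by (auto simp: class_K_def strict_mono_on_def)
  then show "f s \<le> f t" if "0 \<le> s" "s \<le> t" for s t using that by (cases "s = t") (auto intro: less_imp_le)
  show "continuous_on {0..} f" "f 0 = 0" "\<And>s. 0 \<le> s \<Longrightarrow> 0 \<le> f s" using assms by (auto simp: class_K_def)
  then show "0 < f s" if "0 < s" for s using st[of 0 s] that by simp
qed

lemma class_K_infI: "f \<in> class_K \<Longrightarrow> (\<And>M. \<exists>s\<ge>0. M < f s) \<Longrightarrow> f \<in> class_K_inf"
  by (simp add: class_K_inf_def bdd_above_def Bex_def not_le)

lemma class_K_inf_imp_K: "f \<in> class_K_inf \<Longrightarrow> f \<in> class_K"
  by (simp add: class_K_inf_def)

lemma class_K_inf_unbounded: "f \<in> class_K_inf \<Longrightarrow> \<exists>s\<ge>0. M < f s"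
  by (simp add: class_K_inf_def bdd_above_def Bex_def not_le)

lemma class_K_compose:
  assumes f: "f \<in> class_K" and g: "g \<in> class_K"
  shows "(\<lambda>s. f (g s)) \<in> class_K"
proof (rule class_KI)
  have "g ` {0..} \<subseteq> {0..}" using class_K_nonneg[OF g] by auto
  then show "continuous_on {0..} (\<lambda>s. f (g s))"
    using continuous_on_compose2[OF class_K_continuous[OF f] class_K_continuous[OF g]] by auto
qed (use class_K_strict[OF f] class_K_strict[OF g] class_K_nonneg[OF g] class_K_0[OF f] class_K_0[OF g] in auto)

lemma class_K_inf_surj:
  assumes f: "f \<in> class_K_inf" and y: "0 \<le> y"
  shows "\<exists>s\<ge>0. f s = y"
proof -
  note fK = class_K_inf_imp_K[OF f]
  obtain t where t: "0 \<le> t" "y < f t" using class_K_inf_unbounded[OF f] by blast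
  have "continuous_on {0..t} f" using class_K_continuous[OF fK] by (rule continuous_on_subset) auto
  then show ?thesis using IVT'[of f 0 y t] t y class_K_0[OF fK] by auto
qed

lemma class_K_inf_compose:
  assumes f: "f \<in> class_K_inf" and g: "g \<in> class_K_inf"
  shows "(\<lambda>s. f (g s)) \<in> class_K_inf"
proof (rule class_K_infI)
  show "(\<lambda>s. f (g s)) \<in> class_K" by (rule class_K_compose[OF class_K_inf_imp_K[OF f] class_K_inf_imp_K[OF g]])
  fix M
  obtain t where t: "0 \<le> t" "M < f t" using class_K_inf_unbounded[OF f] by blast
  obtain s where "0 \<le> s" "g s = t" using class_K_inf_surj[OF g t(1)] by blast
  then show "\<exists>s\<ge>0. M < f (g s)" using t by blast
qed

lemma class_K_inf_inverse:
  assumes f: "f \<in> class_K_inf"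
  obtains g where "g \<in> class_K_inf" "\<And>s. 0 \<le> s \<Longrightarrow> f (g s) = s" "\<And>s. 0 \<le> s \<Longrightarrow> g (f s) = s"
proof -
  note fK = class_K_inf_imp_K[OF f]
  have "\<exists>g. \<forall>y\<ge>0. 0 \<le> g y \<and> f (g y) = y" using class_K_inf_surj[OF f] by meson
  then obtain g where g: "\<And>y. 0 \<le> y \<Longrightarrow> 0 \<le> g y" "\<And>y. 0 \<le> y \<Longrightarrow> f (g y) = y" by blast
  have inj: "s = t" if "0 \<le> s" "0 \<le> t" "f s = f t" for s t
    using class_K_strict[OF fK, of s t] class_K_strict[OF fK, of t s] that by (cases s t rule: linorder_cases) auto
  have gf: "g (f s) = s" if "0 \<le> s" for s
    using that class_K_nonneg[OF fK that] by (intro inj[of "g (f s)" s] g)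
  have gst: "g s < g t" if "0 \<le> s" "s < t" for s t
    using class_K_mono[OF fK, of "g t" "g s"] g[of s] g[of t] that by force
  \<comment> \<open>Continuity of the inverse comes from monotonicity and an open range. Extending
    \<open>g\<close> by the identity to negative arguments makes the range all of the reals.\<close>
  define G where "G y = (if y < 0 then y else g y)" for y
  have "range G = UNIV"
  proof (rule surjI)
    show "G (if y < 0 then y else f y) = y" for y
      using class_K_nonneg[OF fK, of y] gf[of y] by (auto simp: G_def)
  qed
  moreover have "G s \<le> G t" if "s \<le> t" for s t
    using that gst[of s t] g(1)[of t] by (cases "s = t") (auto simp: G_def)
  ultimately have "continuous_on UNIV G" by (intro continuous_onI_mono) auto
  then have "continuous_on {0..} G" by (rule continuous_on_subset) simp
  then have "continuous_on {0..} g" by (rule continuous_on_eq) (auto simp: G_def)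
  moreover have "g 0 = 0" using gf[of 0] class_K_0[OF fK] by simp
  ultimately have gK: "g \<in> class_K" using gst by (intro class_KI) auto
  have "g \<in> class_K_inf"
  proof (rule class_K_infI[OF gK])
    fix M :: real
    have "M < g (f (\<bar>M\<bar> + 1))" by (subst gf) auto
    then show "\<exists>s\<ge>0. M < g s" using class_K_nonneg[OF fK, of "\<bar>M\<bar> + 1"] by auto
  qed
  then show ?thesis using that g gf by blast
qed

lemma class_K_add:
  assumes f: "f \<in> class_K" and g: "g \<in> class_K"
  shows "(\<lambda>s. f s + g s) \<in> class_K"
proof (rule class_KI)
  show "continuous_on {0..} (\<lambda>s. f s + g s)"
    by (rule continuous_on_add[OF class_K_continuous[OF f] class_K_continuous[OF g]])
  show "f s + g s < f t + g t" if "0 \<le> s" "s < t" for s t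
    using class_K_strict[OF f that] class_K_strict[OF g that] by simp
qed (simp add: class_K_0[OF f] class_K_0[OF g])

lemma class_K_inf_add:
  assumes "f \<in> class_K" "g \<in> class_K_inf"
  shows "(\<lambda>s. f s + g s) \<in> class_K_inf"
proof (rule class_K_infI)
  show "(\<lambda>s. f s + g s) \<in> class_K" by (rule class_K_add[OF assms(1) class_K_inf_imp_K[OF assms(2)]])
  fix M
  obtain s where "0 \<le> s" "M < g s" using class_K_inf_unbounded[OF assms(2)] by blast
  then show "\<exists>s\<ge>0. M < f s + g s" using class_K_nonneg[OF assms(1), of s] by (intro exI[of _ s]) auto
qed

lemma class_K_scale:
  assumes f: "f \<in> class_K" and c: "0 < c"
  shows "(\<lambda>s. c * f s) \<in> class_K"
proof (rule class_KI)
  show "continuous_on {0..} (\<lambda>s. c * f s)"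
    by (rule continuous_on_mult_left[OF class_K_continuous[OF f]])
  show "c * f s < c * f t" if "0 \<le> s" "s < t" for s t
    using class_K_strict[OF f that] c by simp
qed (simp add: class_K_0[OF f])

lemma class_K_inf_scale:
  assumes "f \<in> class_K_inf" "0 < c"
  shows "(\<lambda>s. c * f s) \<in> class_K_inf"
proof (rule class_K_infI)
  show "(\<lambda>s. c * f s) \<in> class_K" by (rule class_K_scale[OF class_K_inf_imp_K[OF assms(1)] assms(2)])
  fix M
  obtain s where "0 \<le> s" "M / c < f s" using class_K_inf_unbounded[OF assms(1)] by blast
  then show "\<exists>s\<ge>0. M < c * f s" using assms(2) by (auto simp: field_simps)
qed

lemma class_K_inf_ident: "(\<lambda>s. s) \<in> class_K_inf"
proof (rule class_K_infI)
  show "(\<lambda>s. s) \<in> class_K" by (rule class_KI) (auto simp: continuous_on_id)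
  show "\<exists>s\<ge>0. M < s" for M :: real by (intro exI[of _ "\<bar>M\<bar> + 1"]) auto
qed

lemma class_K_min:
  assumes f: "f \<in> class_K" and g: "g \<in> class_K"
  shows "(\<lambda>s. min (f s) (g s)) \<in> class_K"
proof (rule class_KI)
  show "continuous_on {0..} (\<lambda>s. min (f s) (g s))"
    by (rule continuous_on_min[OF class_K_continuous[OF f] class_K_continuous[OF g]])
  show "min (f s) (g s) < min (f t) (g t)" if "0 \<le> s" "s < t" for s t
    using class_K_strict[OF f that] class_K_strict[OF g that] by linarith
qed (simp add: class_K_0[OF f] class_K_0[OF g])

text \<open>The second factor need not vanish at \<open>0\<close> nor increase strictly; this covers
  a function plus a positive constant as well as bounded factors.\<close>

lemma class_K_mult:
  assumes f: "f \<in> class_K" and g: "continuous_on {0..} g" "\<And>s t. 0 \<le> s \<Longrightarrow> s \<le> t \<Longrightarrow> g s \<le> g t"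
    "\<And>s. 0 < s \<Longrightarrow> 0 < g s"
  shows "(\<lambda>s. f s * g s) \<in> class_K"
proof (rule class_KI)
  show "continuous_on {0..} (\<lambda>s. f s * g s)" by (intro continuous_on_mult class_K_continuous[OF f] g)
  fix s t :: real assume st: "0 \<le> s" "s < t"
  show "f s * g s < f t * g t"
  proof (cases "s = 0")
    case True
    then show ?thesis using st class_K_0[OF f] class_K_pos[OF f, of t] g(3)[of t] by simp
  next
    case False
    have "f s * g s < f t * g s" using st False class_K_strict[OF f st] g(3)[of s] by simp
    also have "\<dots> \<le> f t * g t" using st class_K_nonneg[OF f, of t] g(2)[of s t] by (intro mult_left_mono) auto
    finally show ?thesis .
  qed
qed (simp add: class_K_0[OF f])

lemma class_K_inf_mult:
  assumes f: "f \<in> class_K_inf" and g: "continuous_on {0..} g" "\<And>s t. 0 \<le> s \<Longrightarrow> s \<le> t \<Longrightarrow> g s \<le> g t"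
    "\<And>s. 0 < s \<Longrightarrow> 0 < g s"
  shows "(\<lambda>s. f s * g s) \<in> class_K_inf"
proof (rule class_K_infI)
  note fK = class_K_inf_imp_K[OF f]
  show "(\<lambda>s. f s * g s) \<in> class_K" by (rule class_K_mult[OF fK g])
  fix M
  obtain s where s: "0 \<le> s" "\<bar>M\<bar> / g 1 < f s" using class_K_inf_unbounded[OF f] by blast
  have "M \<le> \<bar>M\<bar>" by simp
  also have "\<bar>M\<bar> < f s * g 1" using s g(3)[of 1] by (simp add: field_simps)
  \<comment> \<open>Near \<open>0\<close> there is no positive lower bound for \<open>g\<close>,
    hence the passage to an argument at least \<open>1\<close>.\<close>
  also have "\<dots> \<le> f (max s 1) * g (max s 1)"
    using s g(3)[of 1] 
  proof (intro mult_mono)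
    show "f s \<le> f (max s 1)" using s by (intro class_K_mono[OF fK]) auto
    show "g 1 \<le> g (max s 1)" by (rule g(2)) auto
    show "0 \<le> f (max s 1)" by (rule class_K_nonneg[OF fK]) auto
  qed (use g(3)[of 1] in auto)
  finally show "\<exists>s\<ge>0. M < f s * g s" by (intro exI[of _ "max s 1"]) auto
qed

lemma class_K_inf_power2: "(\<lambda>s. s\<^sup>2) \<in> class_K_inf"
  using class_K_inf_mult[OF class_K_inf_ident, of "\<lambda>s. s"] by (simp add: power2_eq_square continuous_on_id)

text \<open>If \<open>V T\<close> exceeds \<open>ai (2 * b)\<close>, then \<open>V \<ge> V T\<close> on the whole interval, so \<open>V\<close> decreases at rate at
  least \<open>a (V T) / 2\<close> and \<open>a (V T) * T / 2 \<le> V 0\<close>. This yields an explicit \<open>KL\<close> bound.\<close>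
lemma comparison_nonpos_deriv:
  fixes V :: "real \<Rightarrow> real"
  assumes T: "0 \<le> T" and V: "abs_cont_on {0..T} V" and V0: "\<And>t. 0 \<le> V t"
    and a: "a \<in> class_K_inf" and ai: "ai \<in> class_K_inf" "\<And>s. 0 \<le> s \<Longrightarrow> a (ai s) = s" "\<And>s. 0 \<le> s \<Longrightarrow> ai (a s) = s"
    and N: "negligible N" and b: "0 \<le> b"
    and deriv: "\<And>t. t \<in> {0..T} - N \<Longrightarrow> \<exists>D. (V has_real_derivative D) (at t within {0..T}) \<and> D \<le> b - a (V t)"
  shows "V T \<le> max (if T = 0 then V 0 else min (V 0) (ai (2 * V 0 / T))) (ai (2 * b))"
proof (cases "V T \<le> ai (2 * b)")
  case False
  note aK = class_K_inf_imp_K[OF a] and aiK = class_K_inf_imp_K[OF ai(1)]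
  define e where "e = V T"
  define r where "r = ai (2 * b)"
  have r: "0 \<le> r" "a r = 2 * b" "r < e" using b ai(2)[of "2 * b"] class_K_nonneg[OF aiK, of "2 * b"] False
    by (auto simp: r_def e_def)
  have low: "e \<le> V \<tau>" if \<tau>: "\<tau> \<in> {0..T}" for \<tau>
  proof (rule ccontr)
    assume "\<not> e \<le> V \<tau>"
    \<comment> \<open>A level below \<open>e\<close> but at least \<open>r\<close>. After the last
      time \<open>\<sigma>\<close> at which \<open>V \<le> m\<close>, the function exceeds
      \<open>r\<close>, so it is non-increasing up to \<open>T\<close>; then
      \<open>V T \<le> m < e\<close>, a contradiction.\<close>
    define m where "m = max r (V \<tau>)"
    have m: "m < e" "r \<le> m" using r \<open>\<not> e \<le> V \<tau>\<close> by (auto simp: m_def)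
    define S where "S = {s \<in> {\<tau>..T}. V s \<le> m}"
    have "continuous_on {\<tau>..T} V" using abs_cont_on_imp_continuous_on[OF V] by (rule continuous_on_subset) (use \<tau> in auto)
    then have "closed S" unfolding S_def by (intro continuous_on_closed_Collect_le continuous_on_const) auto
    moreover have S: "\<tau> \<in> S" "bdd_above S" using \<tau> by (auto simp: S_def m_def bdd_above_def)
    ultimately have "Sup S \<in> S" using closed_contains_Sup by blast
    define \<sigma> where "\<sigma> = Sup S"
    have \<sigma>: "\<sigma> \<in> {\<tau>..T}" "V \<sigma> \<le> m" using \<open>Sup S \<in> S\<close> by (auto simp: \<sigma>_def S_def)
    have above: "m < V s" if "s \<in> {\<sigma>..T}" "s \<noteq> \<sigma>" for s
    proof (rule ccontr)
      assume "\<not> m < V s"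
      then have "s \<in> S" using that \<sigma> by (auto simp: S_def)
      then have "s \<le> \<sigma>" using S(2) by (auto simp: \<sigma>_def intro: cSup_upper)
      then show False using that by auto
    qed
    have sub: "{\<sigma>..T} \<subseteq> {0..T}" using \<sigma> \<tau> by auto
    have "V T \<le> V \<sigma>"
    proof (rule abs_cont_on_nonpos_deriv_imp_le[of \<sigma> T V "insert \<sigma> N"])
      show "\<sigma> \<le> T" "abs_cont_on {\<sigma>..T} V" using \<sigma> abs_cont_on_subset[OF V sub] by auto
      show "negligible (insert \<sigma> N)" using N by simp
      fix t assume t: "t \<in> {\<sigma>..T} - insert \<sigma> N"
      then obtain D where D: "(V has_real_derivative D) (at t within {0..T})" "D \<le> b - a (V t)"
        using deriv[of t] sub by blast
      have "a r \<le> a (V t)" using above[of t] t m r by (intro class_K_mono[OF aK]) auto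
      then have "D \<le> 0" using D(2) r b by linarith
      moreover have "(V has_real_derivative D) (at t within {\<sigma>..T})" using D(1) sub by (rule has_field_derivative_subset)
      ultimately show "\<exists>D\<le>0. (V has_real_derivative D) (at t within {\<sigma>..T})" by blast
    qed
    then show False using \<sigma> m by (simp add: e_def)
  qed
  \<comment> \<open>By \<open>low\<close> the decay is at least \<open>a e\<close> throughout, and
    \<open>b = a r / 2\<close> uses up at most half of it.\<close>
  define k where "k = a e / 2"
  have k: "0 \<le> k" using r class_K_nonneg[OF aK, of e] by (simp add: k_def)
  have "V T + k * T \<le> V 0 + k * 0"
  proof (rule abs_cont_on_nonpos_deriv_imp_le[where f = "\<lambda>t. V t + k * t", OF T _ N])
    show "abs_cont_on {0..T} (\<lambda>t. V t + k * t)"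
    proof (rule abs_cont_on_dominated[OF V abs_cont_on_ident])
      fix s t
      have "norm (V s + k * s - (V t + k * t)) = norm ((V s - V t) + k * (s - t))" by (simp add: algebra_simps)
      also have "\<dots> \<le> norm (V s - V t) + norm (k * (s - t))" by (rule norm_triangle_ineq)
      also have "\<dots> = 1 * norm (V s - V t) + k * norm (s - t)" using k by (simp add: abs_mult)
      finally show "norm (V s + k * s - (V t + k * t)) \<le> 1 * norm (V s - V t) + k * norm (s - t)" .
    qed
    fix t assume t: "t \<in> {0..T} - N"
    then obtain D where D: "(V has_real_derivative D) (at t within {0..T})" "D \<le> b - a (V t)"
      using deriv[of t] by blast
    have "a r \<le> a e" using r by (intro class_K_mono[OF aK]) auto
    moreover have "a e \<le> a (V t)" using low[of t] t r by (intro class_K_mono[OF aK]) auto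
    ultimately have "D + k \<le> 0" using D(2) r(2) by (simp add: k_def)
    moreover have "((\<lambda>t. V t + k * t) has_real_derivative D + k) (at t within {0..T})"
      using D(1) by (auto intro!: derivative_eq_intros)
    ultimately show "\<exists>D\<le>0. ((\<lambda>t. V t + k * t) has_real_derivative D) (at t within {0..T})" by blast
  qed
  then have fin: "e + k * T \<le> V 0" by (simp add: e_def)
  then have "e \<le> V 0" using k T by (smt (verit) mult_nonneg_nonneg)
  moreover have "e \<le> ai (2 * V 0 / T)" if "T \<noteq> 0"
  proof -
    have "a e \<le> 2 * V 0 / T" using fin r that T by (simp add: k_def field_simps)
    then have "ai (a e) \<le> ai (2 * V 0 / T)" using r class_K_nonneg[OF aK, of e] by (intro class_K_mono[OF aiK]) auto
    then show ?thesis using ai(3)[of e] r by simp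
  qed
  ultimately show ?thesis by (auto simp: e_def le_max_iff_disj)
qed auto

text \<open>Shifting \<open>V\<close> by the equilibrium value \<open>b / \<gamma>\<close> and
  multiplying by the integrating factor \<open>exp (\<gamma> * t)\<close> gives an absolutely
  continuous function with nonpositive derivative almost everywhere.\<close>

lemma gronwall_abs_cont:
  fixes V :: "real \<Rightarrow> real"
  assumes T: "0 \<le> T" and V: "abs_cont_on {0..T} V" and N: "negligible N" and \<gamma>: "0 < \<gamma>" and b: "0 \<le> b"
    and deriv: "\<And>t. t \<in> {0..T} - N \<Longrightarrow> \<exists>D. (V has_real_derivative D) (at t within {0..T}) \<and> D \<le> b - \<gamma> * V t"
  shows "V T \<le> exp (- \<gamma> * T) * V 0 + b / \<gamma>"
proof -
  define U where "U t = V t - b / \<gamma>" for t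
  have "compact (V ` {0..T})"
    using abs_cont_on_imp_continuous_on[OF V] by (intro compact_continuous_image) auto
  then obtain R where R: "\<And>t. t \<in> {0..T} \<Longrightarrow> \<bar>V t\<bar> \<le> R"
    using compact_imp_bounded bounded_real by (metis imageI)
  have Ub: "\<bar>U t\<bar> \<le> R + b / \<gamma>" if "t \<in> {0..T}" for t
  proof -
    have "\<bar>U t\<bar> \<le> \<bar>V t\<bar> + \<bar>b / \<gamma>\<bar>" unfolding U_def by (rule abs_triangle_ineq4)
    then show ?thesis using R[OF that] b \<gamma> by simp
  qed
  have "exp (\<gamma> * T) * U T \<le> exp (\<gamma> * 0) * U 0"
  proof (rule abs_cont_on_nonpos_deriv_imp_le[where f = "\<lambda>t. exp (\<gamma> * t) * U t", OF T _ N])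
    show "abs_cont_on {0..T} (\<lambda>t. exp (\<gamma> * t) * U t)"
    proof (rule abs_cont_on_dominated[OF V abs_cont_on_ident])
      fix s t assume st: "s \<in> {0..T}" "t \<in> {0..T}"
      have "norm (exp (\<gamma> * s) - exp (\<gamma> * t)) \<le> (exp (\<gamma> * T) * \<gamma>) * norm (s - t)"
      proof (rule field_differentiable_bound[OF convex_real_interval(5)[of 0 T]])
        fix z assume z: "z \<in> {0..T}"
        show "((\<lambda>z. exp (\<gamma> * z)) has_field_derivative exp (\<gamma> * z) * \<gamma>) (at z within {0..T})"
          by (auto intro!: derivative_eq_intros)
        show "norm (exp (\<gamma> * z) * \<gamma>) \<le> exp (\<gamma> * T) * \<gamma>" using z \<gamma> by simp
      qed (use st in auto)
      then have "norm (exp (\<gamma> * s) - exp (\<gamma> * t)) * norm (U t) \<le> ((exp (\<gamma> * T) * \<gamma>) * norm (s - t)) * (R + b / \<gamma>)"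
        using Ub[OF st(2)] \<gamma> by (intro mult_mono) auto
      moreover have "norm (exp (\<gamma> * s)) * norm (V s - V t) \<le> exp (\<gamma> * T) * norm (V s - V t)"
        using st \<gamma> by (intro mult_right_mono) auto
      moreover have "norm (exp (\<gamma> * s) * U s - exp (\<gamma> * t) * U t)
          \<le> norm (exp (\<gamma> * s)) * norm (V s - V t) + norm (exp (\<gamma> * s) - exp (\<gamma> * t)) * norm (U t)"
      proof -
        have "exp (\<gamma> * s) * U s - exp (\<gamma> * t) * U t = exp (\<gamma> * s) * (V s - V t) + (exp (\<gamma> * s) - exp (\<gamma> * t)) * U t"
          by (simp add: U_def algebra_simps)
        then show ?thesis by (metis norm_triangle_ineq norm_mult)
      qed
      ultimately show "norm (exp (\<gamma> * s) * U s - exp (\<gamma> * t) * U t)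
          \<le> exp (\<gamma> * T) * norm (V s - V t) + (exp (\<gamma> * T) * \<gamma> * (R + b / \<gamma>)) * norm (s - t)"
        by (simp add: mult_ac)
    qed
    fix t assume t: "t \<in> {0..T} - N"
    then obtain D where D: "(V has_real_derivative D) (at t within {0..T})" "D \<le> b - \<gamma> * V t"
      using deriv[of t] by blast
    have "((\<lambda>t. exp (\<gamma> * t) * U t) has_real_derivative exp (\<gamma> * t) * (D + \<gamma> * V t - b)) (at t within {0..T})"
      unfolding U_def using D(1) \<gamma> by (auto intro!: derivative_eq_intros simp: field_simps)
    moreover have "exp (\<gamma> * t) * (D + \<gamma> * V t - b) \<le> 0" using D(2) by (intro mult_nonneg_nonpos) auto
    ultimately show "\<exists>D\<le>0. ((\<lambda>t. exp (\<gamma> * t) * U t) has_real_derivative D) (at t within {0..T})" by blast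
  qed
  then have "U T \<le> exp (- \<gamma> * T) * U 0" by (simp add: exp_minus field_simps)
  also have "\<dots> \<le> exp (- \<gamma> * T) * V 0" using b \<gamma> by (intro mult_left_mono) (auto simp: U_def)
  finally show ?thesis by (simp add: U_def)
qed

section \<open>Trajectories\<close>

lemma AE_lebesgue_on_negligible:
  assumes S: "S \<in> sets lebesgue" and P: "AE t in lebesgue_on S. P t"
  obtains N where "negligible N" "\<And>t. t \<in> S - N \<Longrightarrow> P t"
proof -
  have "AE t in lebesgue. t \<in> S \<longrightarrow> P t"
    using P S by (simp add: AE_restrict_space_iff)
  then obtain N where "N \<in> null_sets lebesgue" "{t \<in> space lebesgue. \<not> (t \<in> S \<longrightarrow> P t)} \<subseteq> N"
    unfolding eventually_ae_filter by blast
  then show ?thesis using that[of N] by (auto simp: negligible_iff_null_sets)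
qed

lemma L_inf_norm_nonneg: "0 \<le> L_inf_norm I v"
  by (simp add: L_inf_norm_def)

lemma AE_norm_le_L_inf_norm:
  assumes "v \<in> L_inf I"
  shows "AE t in lebesgue_on I. norm (v t) \<le> L_inf_norm I v"
proof -
  have "esssup (lebesgue_on I) (\<lambda>t. ennreal (norm (v t))) < top" using assms by (simp add: L_inf_def)
  then have eq: "ennreal (L_inf_norm I v) = esssup (lebesgue_on I) (\<lambda>t. ennreal (norm (v t)))"
    by (simp add: L_inf_norm_def)
  have "AE t in lebesgue_on I. ennreal (norm (v t)) \<le> ennreal (L_inf_norm I v)"
    unfolding eq by (rule esssup_AE)
  then show ?thesis by (simp add: L_inf_norm_nonneg)
qed

lemma L_inf_subset:
  assumes v: "v \<in> L_inf S" and IS: "I \<subseteq> S" "I \<in> sets lebesgue" "S \<in> sets lebesgue"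
  shows "v \<in> L_inf I" and "L_inf_norm I v \<le> L_inf_norm S v"
proof -
  let ?e = "\<lambda>I. esssup (lebesgue_on I) (\<lambda>t. ennreal (norm (v t)))"
  have m: "v \<in> borel_measurable (lebesgue_on I)"
    using v IS(1) by (auto simp: L_inf_def intro: measurable_restrict_mono)
  have "AE t in lebesgue_on S. ennreal (norm (v t)) \<le> ?e S" by (rule esssup_AE)
  then have "AE t in lebesgue_on I. ennreal (norm (v t)) \<le> ?e S"
    using IS by (auto simp: AE_restrict_space_iff)
  then have le: "?e I \<le> ?e S" using m by (intro esssup_I) auto
  have fin: "?e S < top" using v by (simp add: L_inf_def)
  show "v \<in> L_inf I" using m le_less_trans[OF le fin] by (simp add: L_inf_def)
  show "L_inf_norm I v \<le> L_inf_norm S v" unfolding L_inf_norm_def by (rule enn2real_mono[OF le fin])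
qed

text \<open>Collects on a fixed horizon all that the Lyapunov arguments use, with one negligible
  exceptional set for the inclusion and the input bound together.\<close>

lemma B_inc_inf_trajectory:
  assumes vx: "(v, x) \<in> B_inc_inf A B C F" and T: "0 \<le> T"
  obtains N where "negligible N" "abs_cont_on {0..T} x"
    "\<And>t. t \<in> {0..T} - N \<Longrightarrow> norm (v t) \<le> L_inf_norm {0<..<T} v"
    "\<And>t. t \<in> {0..T} - N \<Longrightarrow> \<exists>w\<in>F (C *v x t).
        (x has_vector_derivative (A *v x t + B *v (v t - w))) (at t within {0..T})"
proof -
  have ac: "abs_cont_on {0..T} x" using vx T
    by (auto simp: B_inc_inf_def B_inc_def W11_loc_def abs_continuous_on_eq)
  have "v \<in> L_inf {0..T}" using vx T by (auto simp: B_inc_inf_def L_inf_loc_def)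
  then have "v \<in> L_inf {0<..<T}" by (rule L_inf_subset) auto
  then obtain N1 where N1: "negligible N1" "\<And>t. t \<in> {0<..<T} - N1 \<Longrightarrow> norm (v t) \<le> L_inf_norm {0<..<T} v"
    using AE_lebesgue_on_negligible[OF _ AE_norm_le_L_inf_norm] by (metis lmeasurable_box box_real(1) fmeasurableD)
  have "AE t in lebesgue_on {0..}. \<exists>dx.
           (x has_vector_derivative dx) (at t within {0..}) \<and>
           dx - A *v x t - B *v v t \<in> (\<lambda>w. - (B *v w)) ` F (C *v x t)"
    using vx by (auto simp: B_inc_inf_def B_inc_def)
  then obtain N2 where N2: "negligible N2" "\<And>t. t \<in> {0..} - N2 \<Longrightarrow> \<exists>dx.
           (x has_vector_derivative dx) (at t within {0..}) \<and>
           dx - A *v x t - B *v v t \<in> (\<lambda>w. - (B *v w)) ` F (C *v x t)"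
    by (rule AE_lebesgue_on_negligible[rotated]) auto
  show ?thesis
  \<comment> \<open>The endpoints are exceptional because the input norm is taken over the open
    interval; for \<open>T = 0\<close> nothing remains to be checked.\<close>
  proof (rule that[of "N1 \<union> N2 \<union> {0, T}"])
    show "negligible (N1 \<union> N2 \<union> {0, T})" using N1(1) N2(1) by (intro negligible_Un) auto
    show "abs_cont_on {0..T} x" by (rule ac)
    fix t assume t: "t \<in> {0..T} - (N1 \<union> N2 \<union> {0, T})"
    show "norm (v t) \<le> L_inf_norm {0<..<T} v" using t by (intro N1(2)) auto
    have "t \<in> {0..} - N2" using t by auto
    then obtain dx w where dx: "(x has_vector_derivative dx) (at t within {0..})" "w \<in> F (C *v x t)"
      "dx - A *v x t - B *v v t = - (B *v w)" using N2(2)[of t] by blast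
    have "dx = A *v x t + B *v (v t - w)" using dx(3) by (simp add: matrix_vector_mult_diff_distrib algebra_simps)
    moreover have "(x has_vector_derivative dx) (at t within {0..T})"
      using dx(1) by (rule has_vector_derivative_within_subset) auto
    ultimately show "\<exists>w\<in>F (C *v x t).
        (x has_vector_derivative (A *v x t + B *v (v t - w))) (at t within {0..T})"
      using dx(2) by auto
  qed
qed

lemma has_real_derivative_quadratic:
  fixes x :: "real \<Rightarrow> real^'n"
  assumes Q: "pos_semidef Q" and x: "(x has_vector_derivative d) (at t within S)"
  shows "((\<lambda>t. x t \<bullet> (Q *v x t)) has_real_derivative 2 * ((Q *v x t) \<bullet> d)) (at t within S)"
proof -
  have lin: "bounded_linear ((*v) Q)" by (simp add: linear_linear[symmetric])
  have "((\<lambda>t. x t \<bullet> (Q *v x t)) has_vector_derivative (x t \<bullet> (Q *v d) + d \<bullet> (Q *v x t))) (at t within S)"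
    by (rule bounded_bilinear.has_vector_derivative[OF bounded_bilinear_inner x
          bounded_linear.has_vector_derivative[OF lin x]])
  then show ?thesis using pos_semidef_sym[OF Q, of "x t" d]
    by (simp add: has_real_derivative_iff_has_vector_derivative inner_commute)
qed

text \<open>On a compact interval \<open>x\<close> is bounded, and a quadratic form is Lipschitz on
  bounded sets.\<close>

lemma abs_cont_on_quadratic:
  fixes x :: "real \<Rightarrow> real^'n" and Q :: "real^'n^'n"
  assumes x: "abs_cont_on {a..b} x"
  shows "abs_cont_on {a..b} (\<lambda>t. x t \<bullet> (Q *v x t))"
proof -
  have "compact (x ` {a..b})"
    using abs_cont_on_imp_continuous_on[OF x] by (intro compact_continuous_image) auto
  then obtain R where R: "\<And>t. t \<in> {a..b} \<Longrightarrow> norm (x t) \<le> R"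
    using compact_imp_bounded[of "x ` {a..b}"] unfolding bounded_iff by blast
  obtain k where k: "0 < k" "\<And>z. norm (Q *v z) \<le> k * norm z"
    using linear_bounded_pos[OF matrix_vector_mul_linear[of Q]] by auto
  show ?thesis
  proof (rule abs_cont_on_dominated[OF x x])
    fix s t assume st: "s \<in> {a..b}" "t \<in> {a..b}"
    have "x s \<bullet> (Q *v x s) - x t \<bullet> (Q *v x t) = (x s - x t) \<bullet> (Q *v x s) + x t \<bullet> (Q *v (x s - x t))"
      by (simp add: matrix_vector_mult_diff_distrib inner_diff_left inner_diff_right)
    then have "norm (x s \<bullet> (Q *v x s) - x t \<bullet> (Q *v x t))
        \<le> \<bar>(x s - x t) \<bullet> (Q *v x s)\<bar> + \<bar>x t \<bullet> (Q *v (x s - x t))\<bar>" by (simp add: abs_triangle_ineq)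
    also have "\<dots> \<le> norm (x s - x t) * norm (Q *v x s) + norm (x t) * norm (Q *v (x s - x t))"
      by (intro add_mono Cauchy_Schwarz_ineq2)
    also have "\<dots> \<le> norm (x s - x t) * (k * R) + R * (k * norm (x s - x t))"
    proof (intro add_mono mult_mono)
      show "norm (Q *v x s) \<le> k * R"
        using k(2)[of "x s"] mult_left_mono[OF R[OF st(1)], of k] k(1) by linarith
      show "0 \<le> R" using R[OF st(1)] norm_ge_zero[of "x s"] by linarith
    qed (use R st k in auto)
    finally show "norm (x s \<bullet> (Q *v x s) - x t \<bullet> (Q *v x t)) \<le> (k * R) * norm (x s - x t) + (k * R) * norm (x s - x t)"
      by (simp add: mult_ac)
  qed
qed

section \<open>Lyapunov functions for the inclusion\<close>

text \<open>One constant \<open>K\<close> serves for all upper bounds, and only \<open>Q\<close> has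
  a positive lower bound. The data depend on the matrices alone, so constants built from them are
  uniform over trajectories.\<close>

locale lure_lyapunov =
  fixes A P Q :: "real^'n^'n" and B :: "real^'m^'n" and C :: "real^'n^'m" and q K :: real
  assumes P: "pos_semidef P" and Q: "pos_semidef Q" and q: "0 < q" and K: "0 < K"
    and PA: "\<And>x. (P *v x) \<bullet> (A *v x) \<le> 0"
    and PB: "\<And>x u. (P *v x) \<bullet> (B *v u) = u \<bullet> (C *v x)"
    and P_le: "\<And>x. x \<bullet> (P *v x) \<le> K * (norm x)\<^sup>2"
    and Q_ge: "\<And>x. q * (norm x)\<^sup>2 \<le> x \<bullet> (Q *v x)"
    and Q_le: "\<And>x. x \<bullet> (Q *v x) \<le> K * (norm x)\<^sup>2"
    and Q_deriv: "\<And>x v w. 2 * ((Q *v x) \<bullet> (A *v x + B *v (v - w)))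
          \<le> - (norm x)\<^sup>2 + K * norm x * (norm (C *v x) + norm w + norm v)"
begin

lemma P_nonneg: "0 \<le> x \<bullet> (P *v x)"
  using P by (auto simp: pos_semidef_def)

lemma Q_nonneg: "0 \<le> x \<bullet> (Q *v x)"
  using Q by (auto simp: pos_semidef_def)

lemma P_deriv: "2 * ((P *v x) \<bullet> (A *v x + B *v (v - w))) \<le> 2 * (v \<bullet> (C *v x)) - 2 * (w \<bullet> (C *v x))"
  using PA[of x] by (simp add: inner_add_right PB inner_diff_left)

text \<open>Only the sector bounds along the given trajectory are assumed, not membership in the
  correspondence. Hence the estimate applies both when \<open>\<theta>\<close> is linearly bounded
  everywhere and when it is so on the outputs that actually occur.\<close>

lemma exponential_estimate:
  assumes \<epsilon>: "0 < \<epsilon>" and L: "0 < L"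
  obtains M \<gamma> where "0 < M" "0 < \<gamma>"
    "\<And>v x T N b. \<lbrakk>0 \<le> T; abs_cont_on {0..T} x; negligible N; 0 \<le> b;
        \<And>t. t \<in> {0..T} - N \<Longrightarrow> norm (v t) \<le> b;
        \<And>t. t \<in> {0..T} - N \<Longrightarrow> \<exists>w. norm w \<le> L * norm (C *v x t) \<and> \<epsilon> * (norm (C *v x t))\<^sup>2 \<le> w \<bullet> (C *v x t) \<and>
          (x has_vector_derivative (A *v x t + B *v (v t - w))) (at t within {0..T})\<rbrakk>
      \<Longrightarrow> norm (x T) \<le> M * (exp (- \<gamma> * T) * norm (x 0) + b)"
proof -
  \<comment> \<open>\<open>\<kappa>\<close> makes the decay
    \<open>\<kappa> * \<epsilon> * y^2\<close> of the storage part cancel the square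
    \<open>K^2 * (1 + L)^2 * y^2\<close> left by the \<open>Q\<close> part. \<open>n\<close>
    collects the coefficients of the squared input, \<open>g\<close> is the rate at which half of
    \<open>(norm x)^2\<close> dominates \<open>W\<close>, and \<open>q * m\<close> bounds the
    factors of both the initial state and the input.\<close>
  define \<kappa> where "\<kappa> = K\<^sup>2 * (1 + L)\<^sup>2 / \<epsilon>"
  define n where "n = \<kappa> / \<epsilon> + K\<^sup>2"
  define g where "g = 1 / (2 * ((\<kappa> + 1) * K))"
  define m where "m = ((\<kappa> + 1) * K + n / g) / q"
  have \<kappa>: "0 < \<kappa>" using \<epsilon> L K by (simp add: \<kappa>_def)
  have n: "0 < n" using \<kappa> \<epsilon> K by (simp add: n_def add_pos_pos)
  have g: "0 < g" using \<kappa> K by (simp add: g_def)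
  have m: "0 < m" using \<kappa> K n g q by (simp add: m_def add_pos_pos)
  define W where "W x = \<kappa> * (x \<bullet> (P *v x)) + x \<bullet> (Q *v x)" for x
  have W_le: "W x \<le> (\<kappa> + 1) * K * (norm x)\<^sup>2" for x
  proof -
    have "W x \<le> \<kappa> * (K * (norm x)\<^sup>2) + K * (norm x)\<^sup>2"
      unfolding W_def using \<kappa> by (intro add_mono mult_left_mono P_le Q_le) auto
    then show ?thesis by (simp add: algebra_simps)
  qed
  have W_ge: "q * (norm x)\<^sup>2 \<le> W x" for x
    using Q_ge[of x] P_nonneg[of x] \<kappa> by (simp add: W_def add_increasing)
  have decay: "\<kappa> * (2 * ((P *v x) \<bullet> d)) + 2 * ((Q *v x) \<bullet> d) \<le> n * b\<^sup>2 - g * W x"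
    if d: "d = A *v x + B *v (v - w)" and vb: "norm v \<le> b"
      and w: "norm w \<le> L * norm (C *v x)" "\<epsilon> * (norm (C *v x))\<^sup>2 \<le> w \<bullet> (C *v x)" for x d v w b
  proof -
    define X where "X = norm x"
    define y where "y = norm (C *v x)"
    define V where "V = norm v"
    have "2 * ((P *v x) \<bullet> d) \<le> 2 * (V * y) - 2 * (\<epsilon> * y\<^sup>2)"
      using P_deriv[of x v w] w(2) norm_cauchy_schwarz[of v "C *v x"] by (simp add: d V_def y_def)
    also have "2 * (V * y) \<le> \<epsilon> * y\<^sup>2 + V\<^sup>2 / \<epsilon>"
    proof -
      have "0 \<le> (\<epsilon> * y - V)\<^sup>2 / \<epsilon>" using \<epsilon> by simp
      also have "\<dots> = \<epsilon> * y\<^sup>2 + V\<^sup>2 / \<epsilon> - 2 * (V * y)" using \<epsilon> by (simp add: power2_eq_square field_simps)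
      finally show ?thesis by simp
    qed
    finally have 1: "2 * ((P *v x) \<bullet> d) \<le> V\<^sup>2 / \<epsilon> - \<epsilon> * y\<^sup>2" by simp
    have "2 * ((Q *v x) \<bullet> d) \<le> - X\<^sup>2 + K * X * (y + norm w + V)"
      using Q_deriv[of x v w] by (simp add: d X_def y_def V_def)
    also have "K * X * (y + norm w + V) \<le> K * X * ((1 + L) * y + V)"
      using w(1) K by (intro mult_left_mono) (auto simp: X_def y_def algebra_simps)
    also have "\<dots> = X * (K * (1 + L) * y) + X * (K * V)" by (simp add: algebra_simps)
    \<comment> \<open>Each of the two products takes a quarter of \<open>X^2\<close>, so half of the
      decay is left.\<close>
    also have "\<dots> \<le> (X\<^sup>2 / 4 + (K * (1 + L) * y)\<^sup>2) + (X\<^sup>2 / 4 + (K * V)\<^sup>2)"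
    proof (rule add_mono)
      show "X * z \<le> X\<^sup>2 / 4 + z\<^sup>2" for z
        using zero_le_power2[of "X / 2 - z"] by (simp add: power2_diff power_divide)
      then show "X * (K * V) \<le> X\<^sup>2 / 4 + (K * V)\<^sup>2" .
    qed
    finally have 2: "2 * ((Q *v x) \<bullet> d) \<le> - X\<^sup>2 / 2 + K\<^sup>2 * (1 + L)\<^sup>2 * y\<^sup>2 + K\<^sup>2 * V\<^sup>2"
      by (simp add: power_mult_distrib)
    have "\<kappa> * (2 * ((P *v x) \<bullet> d)) \<le> \<kappa> * (V\<^sup>2 / \<epsilon> - \<epsilon> * y\<^sup>2)" using 1 \<kappa> by (intro mult_left_mono) auto
    also have "\<dots> = \<kappa> / \<epsilon> * V\<^sup>2 - K\<^sup>2 * (1 + L)\<^sup>2 * y\<^sup>2" using \<epsilon> by (simp add: \<kappa>_def field_simps)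
    finally have "\<kappa> * (2 * ((P *v x) \<bullet> d)) + 2 * ((Q *v x) \<bullet> d) \<le> n * V\<^sup>2 - X\<^sup>2 / 2"
      using 2 by (simp add: n_def distrib_right)
    moreover have "n * V\<^sup>2 \<le> n * b\<^sup>2" using n vb by (intro mult_left_mono power_mono) (auto simp: V_def)
    moreover have "g * W x \<le> X\<^sup>2 / 2"
    proof -
      have "g * W x \<le> g * ((\<kappa> + 1) * K * X\<^sup>2)" using g W_le[of x] by (intro mult_left_mono) (auto simp: X_def)
      also have "\<dots> = X\<^sup>2 / 2"
      proof -
        have "1 / (2 * p) * (p * z) = z / 2" if "p \<noteq> 0" for p z :: real using that by simp
        then show ?thesis using \<kappa> K by (simp only: g_def) simp
      qed
      finally show ?thesis .
    qed
    ultimately show ?thesis by linarith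
  qed
  show ?thesis
  proof (rule that[of "sqrt m" "g / 2"])
    show "0 < sqrt m" "0 < g / 2" using m g by auto
    fix v :: "real \<Rightarrow> real^'m" and x :: "real \<Rightarrow> real^'n" and T b :: real and N
    assume T: "0 \<le> T" and x: "abs_cont_on {0..T} x" and N: "negligible N" and b: "0 \<le> b"
      and vb: "\<And>t. t \<in> {0..T} - N \<Longrightarrow> norm (v t) \<le> b"
      and w: "\<And>t. t \<in> {0..T} - N \<Longrightarrow> \<exists>w. norm w \<le> L * norm (C *v x t) \<and> \<epsilon> * (norm (C *v x t))\<^sup>2 \<le> w \<bullet> (C *v x t) \<and>
          (x has_vector_derivative (A *v x t + B *v (v t - w))) (at t within {0..T})"
    have "W (x T) \<le> exp (- g * T) * W (x 0) + n * b\<^sup>2 / g"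
    proof (rule gronwall_abs_cont[where V = "\<lambda>t. W (x t)", OF T _ N g])
      show "abs_cont_on {0..T} (\<lambda>t. W (x t))"
      proof (rule abs_cont_on_dominated[OF abs_cont_on_quadratic[OF x, of P] abs_cont_on_quadratic[OF x, of Q]])
        fix s t
        have "W (x s) - W (x t) = \<kappa> * (x s \<bullet> (P *v x s) - x t \<bullet> (P *v x t)) + (x s \<bullet> (Q *v x s) - x t \<bullet> (Q *v x t))"
          by (simp add: W_def algebra_simps)
        then have "norm (W (x s) - W (x t)) \<le> norm (\<kappa> * (x s \<bullet> (P *v x s) - x t \<bullet> (P *v x t))) + norm (x s \<bullet> (Q *v x s) - x t \<bullet> (Q *v x t))"
          by (simp only: norm_triangle_ineq)
        then show "norm (W (x s) - W (x t)) \<le> \<kappa> * norm (x s \<bullet> (P *v x s) - x t \<bullet> (P *v x t)) + 1 * norm (x s \<bullet> (Q *v x s) - x t \<bullet> (Q *v x t))"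
          using \<kappa> by (simp add: abs_mult)
      qed
      show "0 \<le> n * b\<^sup>2" using n by simp
      fix t assume t: "t \<in> {0..T} - N"
      obtain w where w': "norm w \<le> L * norm (C *v x t)" "\<epsilon> * (norm (C *v x t))\<^sup>2 \<le> w \<bullet> (C *v x t)"
          "(x has_vector_derivative (A *v x t + B *v (v t - w))) (at t within {0..T})"
        using w[OF t] by blast
      let ?d = "A *v x t + B *v (v t - w)"
      have "((\<lambda>t. W (x t)) has_real_derivative \<kappa> * (2 * ((P *v x t) \<bullet> ?d)) + 2 * ((Q *v x t) \<bullet> ?d)) (at t within {0..T})"
        unfolding W_def
        by (intro DERIV_add DERIV_cmult has_real_derivative_quadratic P Q w'(3))
      then show "\<exists>D. ((\<lambda>t. W (x t)) has_real_derivative D) (at t within {0..T}) \<and> D \<le> n * b\<^sup>2 - g * W (x t)"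
        using decay[OF refl vb[OF t] w'(1,2)] by blast
    qed
    then have "q * (norm (x T))\<^sup>2 \<le> exp (- g * T) * W (x 0) + n * b\<^sup>2 / g" using W_ge[of "x T"] by linarith
    also have "\<dots> \<le> exp (- g * T) * ((\<kappa> + 1) * K * (norm (x 0))\<^sup>2) + n * b\<^sup>2 / g"
      by (intro add_mono mult_left_mono W_le) auto
    also have "\<dots> \<le> exp (- g * T) * (q * m * (norm (x 0))\<^sup>2) + q * m * b\<^sup>2"
    proof -
      have "(\<kappa> + 1) * K \<le> q * m" "n / g \<le> q * m" using q n g \<kappa> K by (auto simp: m_def)
      then have "exp (- g * T) * ((\<kappa> + 1) * K * (norm (x 0))\<^sup>2) \<le> exp (- g * T) * (q * m * (norm (x 0))\<^sup>2)" "n / g * b\<^sup>2 \<le> q * m * b\<^sup>2"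
        by (intro mult_left_mono mult_right_mono; simp)+
      then show ?thesis unfolding times_divide_eq_left by (rule add_mono)
    qed
    \<comment> \<open>The quadratic estimate is about to be put under a square root, which halves
      the rate and replaces \<open>m\<close> by \<open>sqrt m\<close>.\<close>
    also have "\<dots> = q * (m * ((exp (- (g / 2) * T) * norm (x 0))\<^sup>2 + b\<^sup>2))"
    proof -
      have "exp (- g * T) = (exp (- (g / 2) * T))\<^sup>2" by (simp add: power2_eq_square exp_add[symmetric])
      then show ?thesis by (simp add: power_mult_distrib algebra_simps)
    qed
    finally have "(norm (x T))\<^sup>2 \<le> m * ((exp (- (g / 2) * T) * norm (x 0))\<^sup>2 + b\<^sup>2)" using q by simp
    also have "\<dots> \<le> m * (exp (- (g / 2) * T) * norm (x 0) + b)\<^sup>2"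
      using m b by (intro mult_left_mono) (auto simp: power2_sum)
    also have "\<dots> = (sqrt m * (exp (- (g / 2) * T) * norm (x 0) + b))\<^sup>2" using m by (simp add: power_mult_distrib)
    finally show "norm (x T) \<le> sqrt m * (exp (- (g / 2) * T) * norm (x 0) + b)"
      using m b by (rule_tac power2_le_imp_le) auto
  qed
qed

end

text \<open>\<open>h\<close> is the integral of the weight. The weight is positive away from
  \<open>0\<close>, so \<open>h\<close> increases strictly; at infinity it is bounded below by a
  multiple of an inverse square root, so \<open>h\<close> grows at least like \<open>sqrt s\<close>
  and is unbounded.\<close>

lemma class_K_inf_integral_weight:
  assumes \<beta>: "\<beta> \<in> class_K_inf"
  defines "\<sigma> \<equiv> \<lambda>s. min 1 (\<beta> (sqrt s))"
  obtains h where "h \<in> class_K_inf"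
    "\<And>s. 0 \<le> s \<Longrightarrow> (h has_real_derivative \<sigma> s / (1 + sqrt s)) (at s within {0..})"
proof -
  note \<beta>K = class_K_inf_imp_K[OF \<beta>]
  define \<zeta> where "\<zeta> s = \<sigma> s / (1 + sqrt s)" for s
  define h where "h s = integral {0..s} \<zeta>" for s
  have c\<sigma>: "continuous_on {0..} \<sigma>"
    unfolding \<sigma>_def
    by (intro continuous_on_min continuous_on_const continuous_on_compose2[OF class_K_continuous[OF \<beta>K]]
        continuous_on_real_sqrt continuous_on_id) auto
  have c\<zeta>: "continuous_on {0..} \<zeta>"
    unfolding \<zeta>_def
  proof (intro continuous_on_divide c\<sigma>)
    show "\<forall>s\<in>{0..}. 1 + sqrt s \<noteq> 0"
    proof
      fix s :: real assume "s \<in> {0..}"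
      then have "0 \<le> sqrt s" by simp
      then show "1 + sqrt s \<noteq> 0" by linarith
    qed
  qed (intro continuous_intros)
  have dh: "(h has_real_derivative \<zeta> s) (at s within {0..})" if s: "0 \<le> s" for s
  proof -
    have "((\<lambda>x. integral {0..x} \<zeta>) has_real_derivative \<zeta> s) (at s within {0..s + 1})"
      using s by (intro integral_has_real_derivative continuous_on_subset[OF c\<zeta>]) auto
    \<comment> \<open>The fundamental theorem is applied on a compact interval reaching beyond
      \<open>s\<close>, so that only the boundary point \<open>0\<close> is one-sided.\<close>
    moreover have "at s within {0..s + 1} = at s within {0..}"
      by (rule at_within_nhd[of _ "{..<s + 1}"]) auto
    ultimately show ?thesis by (simp add: h_def[abs_def])
  qed
  have ch: "continuous_on {0..} h"
    using dh by (intro DERIV_continuous_on) auto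
  have pos\<zeta>: "0 < \<zeta> s" if "0 < s" for s
    using class_K_pos[OF \<beta>K, of "sqrt s"] that by (simp add: \<zeta>_def \<sigma>_def add_pos_pos)
  have dh': "DERIV h s :> \<zeta> s" if "0 < s" for s
    using dh[of s] that at_within_interior[of s "{0..}"] by simp
  have hK: "h \<in> class_K"
  proof (rule class_KI[OF ch])
    fix s t :: real assume st: "0 \<le> s" "s < t"
    show "h s < h t"
    proof (rule DERIV_pos_imp_increasing_open[OF st(2)])
      show "\<exists>y. DERIV h x :> y \<and> 0 < y" if "s < x" "x < t" for x
        using dh'[of x] pos\<zeta>[of x] st that by auto
      show "continuous_on {s..t} h" by (rule continuous_on_subset[OF ch]) (use st in auto)
    qed
  qed (simp add: h_def)
  define m where "m = min 1 (\<beta> 1)"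
  have m: "0 < m" using class_K_pos[OF \<beta>K, of 1] by (simp add: m_def)
  have hge: "m * (sqrt s - 1) \<le> h s" if s: "1 \<le> s" for s
  proof -
    have "h 1 - m * sqrt 1 \<le> h s - m * sqrt s"
    proof (rule DERIV_nonneg_imp_nondecreasing[OF s])
      fix x :: real assume x: "1 \<le> x" "x \<le> s"
      have "m \<le> \<sigma> x" using class_K_mono[OF \<beta>K, of 1 "sqrt x"] x by (auto simp: m_def \<sigma>_def)
      \<comment> \<open>For \<open>x \<ge> 1\<close> the denominator \<open>1 + sqrt x\<close> is at
        most \<open>2 * sqrt x\<close>, and \<open>m / (2 * sqrt x)\<close> is the derivative of
        \<open>m * sqrt x\<close>.\<close>
      then have "m / (2 * sqrt x) \<le> \<sigma> x / (1 + sqrt x)" using x m by (intro frac_le) (auto intro: add_pos_nonneg)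
      moreover have "DERIV (\<lambda>s. h s - m * sqrt s) x :> \<zeta> x - m / (2 * sqrt x)"
        using dh'[of x] x by (auto intro!: derivative_eq_intros simp: field_simps)
      ultimately show "\<exists>y. DERIV (\<lambda>s. h s - m * sqrt s) x :> y \<and> 0 \<le> y" by (auto simp: \<zeta>_def)
    qed
    then show ?thesis using class_K_nonneg[OF hK, of 1] by (simp add: algebra_simps)
  qed
  have "h \<in> class_K_inf"
  proof (rule class_K_infI[OF hK])
    fix M :: real
    define r where "r = \<bar>M\<bar> / m + 2"
    have r: "1 \<le> r" using m by (simp add: r_def)
    have "m * (r - 1) = \<bar>M\<bar> + m" using m by (simp add: r_def field_simps)
    then have "M < m * (r - 1)" using m by linarith
    also have "\<dots> \<le> h (r\<^sup>2)" using hge[of "r\<^sup>2"] r by simp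
    finally show "\<exists>s\<ge>0. M < h s" by (intro exI[of _ "r\<^sup>2"]) auto
  qed
  then show ?thesis using that[of h] dh by (simp add: \<zeta>_def)
qed

section \<open>The dissipation inequality and input-to-state stability\<close>

context lure_lyapunov
begin

text \<open>\<open>\<zeta>\<close> is the derivative of the weight \<open>h\<close>. In
  \<open>\<kappa>\<close> the terms \<open>1 / \<alpha> \<mu> + c\<close> pay for the cross term at
  outputs beyond \<open>\<mu>\<close>, the terms \<open>1 + L\<close> for it at smaller ones, and
  \<open>K / sqrt q\<close> comes from the bound on \<open>\<zeta>\<close> times
  \<open>norm x\<close>.\<close>

lemma lyapunov_decay:
  assumes \<alpha>: "\<alpha> \<in> class_K_inf" and \<alpha>i: "\<alpha>i \<in> class_K_inf" "\<And>s. 0 \<le> s \<Longrightarrow> \<alpha>i (\<alpha> s) = s"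
    and c: "0 < c" and \<mu>: "0 < \<mu>" and L: "0 \<le> L" "\<And>s. 0 \<le> s \<Longrightarrow> s \<le> \<mu> \<Longrightarrow> \<theta> s \<le> L * s"
  defines "\<kappa> \<equiv> K / sqrt q * (1 / \<alpha> \<mu> + c + 1 + L)"
    and "\<zeta> \<equiv> \<lambda>s. min 1 (\<alpha> (1 / (sqrt K * (2 * K * (1 + L))) * sqrt s)) / (1 + sqrt s)"
  assumes w: "w \<in> lure_F \<alpha> \<theta> c \<mu> (C *v x)" and d: "d = A *v x + B *v (v - w)"
  shows "\<kappa> * (2 * ((P *v x) \<bullet> d)) + \<zeta> (x \<bullet> (Q *v x)) * (2 * ((Q *v x) \<bullet> d))
    \<le> norm v * (2 * \<kappa> * \<alpha>i (2 * norm v) + K / sqrt q) - \<zeta> (x \<bullet> (Q *v x)) * ((norm x)\<^sup>2 / 2)"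
proof -
  note \<alpha>K = class_K_inf_imp_K[OF \<alpha>] and \<alpha>iK = class_K_inf_imp_K[OF \<alpha>i(1)]
  define X where "X = norm x"
  define y where "y = norm (C *v x)"
  define V where "V = norm v"
  define p where "p = w \<bullet> (C *v x)"
  define s where "s = x \<bullet> (Q *v x)"
  \<comment> \<open>Chosen so that \<open>norm x \<le> 2 * K * (1 + L) * y\<close> implies
    \<open>k * sqrt s \<le> y\<close>.\<close>
  define k where "k = 1 / (sqrt K * (2 * K * (1 + L)))"
  define z where "z = \<zeta> s"
  have nn: "0 \<le> X" "0 \<le> y" "0 \<le> V" "0 \<le> s" "0 < k" using Q_nonneg[of x] K L
    by (auto simp: X_def y_def V_def s_def k_def)
  have \<alpha>\<mu>: "0 < \<alpha> \<mu>" using class_K_pos[OF \<alpha>K \<mu>] .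
  have w\<theta>: "norm w \<le> \<theta> y" and wy: "y * \<alpha> y \<le> p" and wc: "\<mu> < y \<Longrightarrow> norm w \<le> c * p"
    using w by (auto simp: lure_F_def y_def p_def)
  have p0: "0 \<le> p" using wy class_K_nonneg[OF \<alpha>K nn(2)] nn(2) by (meson mult_nonneg_nonneg order_trans)
  have \<kappa>: "0 \<le> \<kappa>" using K q \<alpha>\<mu> c L by (auto simp: \<kappa>_def intro!: mult_nonneg_nonneg add_nonneg_nonneg)
  have \<alpha>ks: "0 \<le> \<alpha> (k * sqrt s)" using nn by (intro class_K_nonneg[OF \<alpha>K]) auto
  have sq: "sqrt q * X \<le> sqrt s"
  proof -
    have "sqrt (q * X\<^sup>2) \<le> sqrt s" using Q_ge[of x] by (simp add: X_def s_def)
    then show ?thesis using nn by (simp add: real_sqrt_mult)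
  qed
  have sK: "sqrt s \<le> sqrt K * X"
  proof -
    have "sqrt s \<le> sqrt (K * X\<^sup>2)" using Q_le[of x] by (simp add: X_def s_def)
    then show ?thesis using nn by (simp add: real_sqrt_mult)
  qed
  have s1: "0 < 1 + sqrt s" using nn by (simp add: add_pos_nonneg)
  have z0: "0 \<le> z" unfolding z_def \<zeta>_def k_def[symmetric] using \<alpha>ks s1 by auto
  \<comment> \<open>The inverse square root at work: \<open>X\<close> is at most
    \<open>sqrt s / sqrt q\<close>, so the denominator of \<open>\<zeta>\<close> cancels its
    growth.\<close>
  have zX: "z * X \<le> min 1 (\<alpha> (k * sqrt s)) / sqrt q"
  proof -
    have "sqrt q * (z * X) = min 1 (\<alpha> (k * sqrt s)) * (sqrt q * X / (1 + sqrt s))"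
      by (simp add: z_def \<zeta>_def k_def)
    also have "\<dots> \<le> min 1 (\<alpha> (k * sqrt s)) * 1"
      using sq s1 \<alpha>ks by (intro mult_left_mono) auto
    finally show ?thesis using q by (simp add: field_simps)
  qed
  have zX1: "z * X \<le> 1 / sqrt q"
    using zX q by (meson divide_right_mono min.cobounded1 order_trans real_sqrt_ge_zero less_imp_le)
  have Pd: "2 * ((P *v x) \<bullet> d) \<le> 2 * V * \<alpha>i (2 * V) - p"
  proof -
    \<comment> \<open>A Young inequality shaped by \<open>\<alpha>\<close>: either half the
      dissipation absorbs the supply \<open>V * y\<close>, or the output is at most
      \<open>\<alpha>i (2 * V)\<close>.\<close>
    have "V * y \<le> p / 2 + V * \<alpha>i (2 * V)"
    proof (cases "2 * V \<le> \<alpha> y")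
      case True
      then have "y * (2 * V) \<le> y * \<alpha> y" using nn by (intro mult_left_mono)
      then have "V * y \<le> p / 2" using wy by (simp add: mult_ac)
      then show ?thesis using nn class_K_nonneg[OF \<alpha>iK, of "2 * V"] by (simp add: add_increasing2)
    next
      case False
      then have "\<alpha>i (\<alpha> y) \<le> \<alpha>i (2 * V)" using class_K_nonneg[OF \<alpha>K nn(2)] by (intro class_K_mono[OF \<alpha>iK]) auto
      then have "V * y \<le> V * \<alpha>i (2 * V)" using nn \<alpha>i(2) by (intro mult_left_mono) auto
      then show ?thesis using p0 by simp
    qed
    then show ?thesis using P_deriv[of x v w] norm_cauchy_schwarz[of v "C *v x"]
      by (simp add: d V_def y_def p_def)
  qed
  have Qd: "2 * ((Q *v x) \<bullet> d) \<le> - X\<^sup>2 + K * X * (y + norm w + V)"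
    using Q_deriv[of x v w] by (simp add: d X_def y_def V_def)
  have KXV: "z * (K * X * V) \<le> K / sqrt q * V"
  proof -
    have "z * (K * X * V) = K * V * (z * X)" by simp
    also have "\<dots> \<le> K * V * (1 / sqrt q)" using zX1 K nn by (intro mult_left_mono) auto
    finally show ?thesis by simp
  qed
  have main: "z * (K * X * (y + norm w)) \<le> z * (X\<^sup>2 / 2) + \<kappa> * p"
  proof (cases "\<mu> < y")
    case True
    have "\<alpha> \<mu> \<le> \<alpha> y" using True \<mu> by (intro class_K_mono[OF \<alpha>K]) auto
    then have "y * \<alpha> \<mu> \<le> p" using wy nn mult_left_mono[of "\<alpha> \<mu>" "\<alpha> y" y] by linarith
    then have "y \<le> p / \<alpha> \<mu>" using \<alpha>\<mu> by (simp add: field_simps)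
    \<comment> \<open>Here the third condition of the correspondence replaces the missing growth
      bound on \<open>\<theta>\<close>.\<close>
    then have yw: "y + norm w \<le> (1 / \<alpha> \<mu> + c) * p" using wc[OF True] by (simp add: distrib_right)
    have "z * (K * X * (y + norm w)) = K * (z * X) * (y + norm w)" by simp
    also have "\<dots> \<le> K * (1 / sqrt q) * ((1 / \<alpha> \<mu> + c) * p)"
      using yw zX1 K nn z0 q by (intro mult_mono mult_left_mono) auto
    also have "\<dots> = K / sqrt q * (1 / \<alpha> \<mu> + c) * p" by simp
    also have "\<dots> \<le> \<kappa> * p" unfolding \<kappa>_def using K q L p0 by (intro mult_right_mono mult_left_mono) auto
    finally show ?thesis using z0 by (simp add: add_increasing)
  next
    case False
    then have "norm w \<le> L * y" using w\<theta> L(2)[of y] nn by simp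
    then have yw: "y + norm w \<le> (1 + L) * y" by (simp add: distrib_right)
    show ?thesis
    \<comment> \<open>At this threshold the cross term is at most half of \<open>X^2\<close>. Below
      it, the state is comparable to the output, and the factor \<open>\<alpha>\<close> inside
      \<open>z\<close> supplies \<open>\<alpha> y\<close>.\<close>
    proof (cases "2 * K * (1 + L) * y \<le> X")
      case True
      have "K * X * (y + norm w) \<le> K * X * ((1 + L) * y)" using yw K nn by (intro mult_left_mono) auto
      also have "\<dots> = X * (2 * K * (1 + L) * y) / 2" by simp
      also have "\<dots> \<le> X * X / 2" using True nn by (intro divide_right_mono mult_left_mono) auto
      finally have "z * (K * X * (y + norm w)) \<le> z * (X\<^sup>2 / 2)" using z0 by (intro mult_left_mono) (auto simp: power2_eq_square)
      then show ?thesis using \<kappa> p0 by (simp add: add_increasing2)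
    next
      case False
      have "k * sqrt s \<le> k * (sqrt K * (2 * K * (1 + L) * y))"
        using False sK nn K by (intro mult_left_mono order_trans[OF sK]) auto
      also have "\<dots> = y" using K L by (simp add: k_def)
      finally have "\<alpha> (k * sqrt s) \<le> \<alpha> y" using nn by (intro class_K_mono[OF \<alpha>K]) auto
      then have "z * X \<le> \<alpha> y / sqrt q" using zX q
        by (meson divide_right_mono min.cobounded2 order_trans real_sqrt_ge_zero less_imp_le)
      then have "K * (z * X) * (y + norm w) \<le> K * (\<alpha> y / sqrt q) * ((1 + L) * y)"
        using yw K nn z0 q class_K_nonneg[OF \<alpha>K nn(2)] by (intro mult_mono mult_left_mono) auto
      also have "\<dots> = K / sqrt q * (1 + L) * (y * \<alpha> y)" by simp
      also have "\<dots> \<le> K / sqrt q * (1 + L) * p" using wy K q L by (intro mult_left_mono) auto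
      also have "\<dots> \<le> \<kappa> * p" unfolding \<kappa>_def using K q \<alpha>\<mu> c p0 by (intro mult_right_mono mult_left_mono) auto
      finally have "z * (K * X * (y + norm w)) \<le> \<kappa> * p" by (simp add: mult_ac)
      then show ?thesis using z0 by (simp add: add_increasing)
    qed
  qed
  have "z * (2 * ((Q *v x) \<bullet> d)) \<le> z * (- X\<^sup>2 + K * X * (y + norm w + V))"
    using Qd z0 by (rule mult_left_mono)
  also have "\<dots> = - z * X\<^sup>2 + z * (K * X * (y + norm w)) + z * (K * X * V)" by (simp add: algebra_simps)
  also have "\<dots> \<le> \<kappa> * p + K / sqrt q * V - z * (X\<^sup>2 / 2)" using main KXV by simp
  finally have "z * (2 * ((Q *v x) \<bullet> d)) \<le> \<kappa> * p + K / sqrt q * V - z * (X\<^sup>2 / 2)" .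
  moreover have "\<kappa> * (2 * ((P *v x) \<bullet> d)) \<le> \<kappa> * (2 * V * \<alpha>i (2 * V) - p)" using Pd \<kappa> by (rule mult_left_mono)
  ultimately have "\<kappa> * (2 * ((P *v x) \<bullet> d)) + z * (2 * ((Q *v x) \<bullet> d))
      \<le> V * (2 * \<kappa> * \<alpha>i (2 * V) + K / sqrt q) - z * (X\<^sup>2 / 2)"
    by (simp add: algebra_simps)
  then show ?thesis by (simp add: z_def s_def V_def X_def)
qed

text \<open>\<open>W\<close> is bounded from both sides by functions of \<open>norm x\<close>, which
  converts \<open>lyapunov_decay\<close> into a scalar inequality for \<open>W\<close> alone. All
  comparison functions are constructed before a trajectory is fixed.\<close>

lemma iss:
  assumes \<alpha>: "\<alpha> \<in> class_K_inf" and c: "0 < c" and \<mu>: "0 < \<mu>"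
    and L: "0 \<le> L" "\<And>s. 0 \<le> s \<Longrightarrow> s \<le> \<mu> \<Longrightarrow> \<theta> s \<le> L * s"
  shows "ISS A B C (lure_F \<alpha> \<theta> c \<mu>)"
proof -
  define k where "k = 1 / (sqrt K * (2 * K * (1 + L)))"
  have k: "0 < k" using K L by (auto simp: k_def)
  obtain \<alpha>i where \<alpha>i: "\<alpha>i \<in> class_K_inf" "\<And>s. 0 \<le> s \<Longrightarrow> \<alpha> (\<alpha>i s) = s" "\<And>s. 0 \<le> s \<Longrightarrow> \<alpha>i (\<alpha> s) = s"
    using class_K_inf_inverse[OF \<alpha>] by blast
  note \<alpha>K = class_K_inf_imp_K[OF \<alpha>] and \<alpha>iK = class_K_inf_imp_K[OF \<alpha>i(1)]
  define \<kappa> where "\<kappa> = K / sqrt q * (1 / \<alpha> \<mu> + c + 1 + L)"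
  have \<alpha>\<mu>: "0 < \<alpha> \<mu>" using class_K_pos[OF \<alpha>K \<mu>] .
  have "0 < 1 / \<alpha> \<mu> + c + 1 + L" using \<alpha>\<mu> c L(1) by (intro add_pos_nonneg add_pos_pos) auto
  then have \<kappa>: "0 < \<kappa>" using K q by (simp add: \<kappa>_def)
  define \<sigma> where "\<sigma> s = min 1 (\<alpha> (k * sqrt s))" for s
  have \<beta>: "(\<lambda>s. \<alpha> (k * s)) \<in> class_K_inf"
    by (rule class_K_inf_compose[OF \<alpha> class_K_inf_scale[OF class_K_inf_ident k]])
  obtain h where h: "h \<in> class_K_inf" "\<And>s. 0 \<le> s \<Longrightarrow> (h has_real_derivative \<sigma> s / (1 + sqrt s)) (at s within {0..})"
    unfolding \<sigma>_def using class_K_inf_integral_weight[OF \<beta>] by blast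
  note hK = class_K_inf_imp_K[OF h(1)]
  define \<rho> where "\<rho> r = r * (2 * \<kappa> * \<alpha>i (2 * r) + K / sqrt q)" for r
  have \<rho>K: "\<rho> \<in> class_K"
    unfolding \<rho>_def
  proof (rule class_K_mult[OF class_K_inf_imp_K[OF class_K_inf_ident]])
    have \<alpha>i2: "(\<lambda>r. \<alpha>i (2 * r)) \<in> class_K"
      by (rule class_K_compose[OF \<alpha>iK class_K_scale[OF class_K_inf_imp_K[OF class_K_inf_ident]]]) simp
    show "continuous_on {0..} (\<lambda>s. 2 * \<kappa> * \<alpha>i (2 * s) + K / sqrt q)"
      by (intro continuous_on_add continuous_on_mult_left continuous_on_const class_K_continuous[OF \<alpha>i2])
    show "2 * \<kappa> * \<alpha>i (2 * s) + K / sqrt q \<le> 2 * \<kappa> * \<alpha>i (2 * t) + K / sqrt q" if "0 \<le> s" "s \<le> t" for s t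
      using class_K_mono[OF \<alpha>i2 that] \<kappa> by simp
    show "0 < 2 * \<kappa> * \<alpha>i (2 * s) + K / sqrt q" if "0 < s" for s
      using class_K_pos[OF \<alpha>i2 that] \<kappa> K q by (intro add_pos_pos mult_pos_pos) auto
  qed
  define a1 where "a1 r = h (q * r\<^sup>2)" for r
  have a1: "a1 \<in> class_K_inf" unfolding a1_def
    by (rule class_K_inf_compose[OF h(1) class_K_inf_scale[OF class_K_inf_power2 q]])
  define a2 where "a2 r = \<kappa> * K * r\<^sup>2 + h (K * r\<^sup>2)" for r
  have a2: "a2 \<in> class_K_inf" unfolding a2_def
    using class_K_inf_add[OF class_K_scale[OF class_K_inf_imp_K[OF class_K_inf_power2], of "\<kappa> * K"]
        class_K_inf_compose[OF h(1) class_K_inf_scale[OF class_K_inf_power2 K]]] \<kappa> K by simp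
  \<comment> \<open>The decay term of \<open>lyapunov_decay\<close> as a function of the norm of the
    state: the form of \<open>Q\<close> is replaced by \<open>q * r^2\<close> in the numerator and
    by \<open>K * r^2\<close> in the denominator. One factor \<open>r\<close> is split off to carry
    the unboundedness; the rest is merely nondecreasing.\<close>
  define a3 where "a3 r = r * (r / (1 + sqrt K * r) * \<sigma> (q * r\<^sup>2) / 2)" for r
  have kq: "k * sqrt (q * r\<^sup>2) = k * sqrt q * r" if "0 \<le> r" for r using that by (simp add: real_sqrt_mult)
  have kq0: "0 < k * sqrt q" using k q by simp
  have \<beta>q: "(\<lambda>r. \<alpha> (k * sqrt q * r)) \<in> class_K"
    by (rule class_K_compose[OF \<alpha>K class_K_scale[OF class_K_inf_imp_K[OF class_K_inf_ident] kq0]])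
  have \<sigma>q: "\<sigma> (q * r\<^sup>2) = min 1 (\<alpha> (k * sqrt q * r))" if "0 \<le> r" for r
    unfolding \<sigma>_def kq[OF that] ..
  have den: "0 < 1 + sqrt K * r" if "0 \<le> r" for r using that K by (simp add: add_pos_nonneg)
  have den': "\<forall>r\<in>{0..}. 1 + sqrt K * r \<noteq> 0" using den by fastforce
  have a3: "a3 \<in> class_K_inf"
    unfolding a3_def
  proof (rule class_K_inf_mult[OF class_K_inf_ident])
    have "continuous_on {0..} (\<lambda>r. r / (1 + sqrt K * r) * min 1 (\<alpha> (k * sqrt q * r)) / 2)"
      by (intro continuous_on_divide continuous_on_mult continuous_on_min continuous_on_add
          continuous_on_const continuous_on_id class_K_continuous[OF \<beta>q] den') auto
    then show "continuous_on {0..} (\<lambda>r. r / (1 + sqrt K * r) * \<sigma> (q * r\<^sup>2) / 2)"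
      by (rule continuous_on_eq) (simp add: \<sigma>q)
    show "s / (1 + sqrt K * s) * \<sigma> (q * s\<^sup>2) / 2 \<le> t / (1 + sqrt K * t) * \<sigma> (q * t\<^sup>2) / 2" if st: "0 \<le> s" "s \<le> t" for s t
    proof -
      have "s / (1 + sqrt K * s) \<le> t / (1 + sqrt K * t)"
      proof -
        have "s * (1 + sqrt K * t) \<le> t * (1 + sqrt K * s)" using st by (simp add: algebra_simps)
        then show ?thesis using den[of s] den[of t] st by (simp add: pos_divide_le_eq pos_le_divide_eq)
      qed
      moreover have "\<sigma> (q * s\<^sup>2) \<le> \<sigma> (q * t\<^sup>2)"
        using class_K_mono[OF \<beta>q st] st by (auto simp: \<sigma>q)
      moreover have "0 \<le> \<sigma> (q * s\<^sup>2)" using class_K_nonneg[OF \<beta>q st(1)] st by (simp add: \<sigma>q)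
      moreover have "0 \<le> t / (1 + sqrt K * t)" using den[of t] st by simp
      ultimately show ?thesis by (intro divide_right_mono mult_mono) auto
    qed
    show "0 < s / (1 + sqrt K * s) * \<sigma> (q * s\<^sup>2) / 2" if "0 < s" for s
      using den[of s] class_K_pos[OF \<beta>q that] that by (simp add: \<sigma>q)
  qed
  obtain a1i where a1i: "a1i \<in> class_K_inf" "\<And>s. 0 \<le> s \<Longrightarrow> a1 (a1i s) = s" "\<And>s. 0 \<le> s \<Longrightarrow> a1i (a1 s) = s"
    using class_K_inf_inverse[OF a1] by blast
  obtain a2i where a2i: "a2i \<in> class_K_inf" "\<And>s. 0 \<le> s \<Longrightarrow> a2 (a2i s) = s" "\<And>s. 0 \<le> s \<Longrightarrow> a2i (a2 s) = s"
    using class_K_inf_inverse[OF a2] by blast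
  \<comment> \<open>Since \<open>W x \<le> a2 (norm x)\<close>, a decay in terms of the state
    becomes a decay in terms of \<open>W\<close>.\<close>
  define a where "a s = a3 (a2i s)" for s
  have a: "a \<in> class_K_inf" unfolding a_def by (rule class_K_inf_compose[OF a3 a2i(1)])
  obtain ai where ai: "ai \<in> class_K_inf" "\<And>s. 0 \<le> s \<Longrightarrow> a (ai s) = s" "\<And>s. 0 \<le> s \<Longrightarrow> ai (a s) = s"
    using class_K_inf_inverse[OF a] by blast
  note a1K = class_K_inf_imp_K[OF a1] and a2K = class_K_inf_imp_K[OF a2] and a3K = class_K_inf_imp_K[OF a3]
    and a1iK = class_K_inf_imp_K[OF a1i(1)] and a2iK = class_K_inf_imp_K[OF a2i(1)] and aiK = class_K_inf_imp_K[OF ai(1)]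
  define W where "W x = \<kappa> * (x \<bullet> (P *v x)) + h (x \<bullet> (Q *v x))" for x
  have W_ge: "a1 (norm x) \<le> W x" for x
  proof -
    have "h (q * (norm x)\<^sup>2) \<le> h (x \<bullet> (Q *v x))" using Q_ge[of x] q by (intro class_K_mono[OF hK]) auto
    then show ?thesis using P_nonneg[of x] \<kappa> by (simp add: W_def a1_def add_increasing)
  qed
  have W_le: "W x \<le> a2 (norm x)" for x
    unfolding W_def a2_def mult.assoc using \<kappa>
    by (intro add_mono mult_left_mono P_le class_K_mono[OF hK Q_nonneg Q_le]) auto
  have W0: "0 \<le> W x" for x using W_ge[of x] class_K_nonneg[OF a1K, of "norm x"] by simp
  \<comment> \<open>The shape is that of \<open>comparison_nonpos_deriv\<close>. Time
    \<open>0\<close> is separate because division by zero yields \<open>0\<close>, which would make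
    the bound \<open>0\<close> there.\<close>
  define \<beta>0 where "\<beta>0 s t = (if t = 0 then a2 s else min (a2 s) (ai (2 / t * a2 s)))" for s t
  have ai_scale: "(\<lambda>s. ai (r * a2 s)) \<in> class_K" if "0 < r" for r
    by (rule class_K_compose[OF aiK class_K_scale[OF a2K that]])
  have \<beta>0K: "(\<lambda>s. \<beta>0 s t) \<in> class_K" if "0 \<le> t" for t
  proof (cases "t = 0")
    case True
    then show ?thesis using a2K by (simp add: \<beta>0_def)
  next
    case False
    then show ?thesis using class_K_min[OF a2K ai_scale[of "2 / t"]] that by (simp add: \<beta>0_def)
  qed
  have \<beta>0_mono: "\<beta>0 s u \<le> \<beta>0 s t" if "0 \<le> s" "0 \<le> t" "t \<le> u" for s t u
  proof (cases "t = 0")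
    case False
    have "2 / u * a2 s \<le> 2 / t * a2 s"
      using that False class_K_nonneg[OF a2K that(1)] by (intro mult_right_mono divide_left_mono) auto
    then have "ai (2 / u * a2 s) \<le> ai (2 / t * a2 s)"
      using that False class_K_nonneg[OF a2K that(1)] by (intro class_K_mono[OF aiK]) auto
    then show ?thesis using that False by (auto simp: \<beta>0_def)
  qed (auto simp: \<beta>0_def)
  define \<psi> where "\<psi> s t = a1i (\<beta>0 s t)" for s t
  have "\<psi> \<in> class_KL"
    unfolding class_KL_def
  proof (intro CollectI conjI allI impI)
    show "(\<lambda>s. \<psi> s t) \<in> class_K" if "0 \<le> t" for t
      unfolding \<psi>_def by (rule class_K_compose[OF a1iK \<beta>0K[OF that]])
    fix s :: real assume s: "0 \<le> s"
    have \<beta>0_nonneg: "0 \<le> \<beta>0 s t" if "0 \<le> t" for t using class_K_nonneg[OF \<beta>0K[OF that] s] .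
    show "antimono_on {0..} (\<psi> s)"
      unfolding \<psi>_def using s \<beta>0_mono[OF s] \<beta>0_nonneg by (intro monotone_onI class_K_mono[OF a1iK]) auto
    have "((\<lambda>t. 2 / t * a2 s) \<longlongrightarrow> 0) at_top"
      by (intro tendsto_mult_left_zero tendsto_divide_0[OF tendsto_const] filterlim_at_top_imp_at_infinity filterlim_ident)
    moreover have "eventually (\<lambda>t. 2 / t * a2 s \<in> {0..}) at_top"
      by (rule eventually_mono[OF eventually_gt_at_top[of 0]]) (simp add: class_K_nonneg[OF a2K s])
    moreover have comp: "(\<lambda>s. a1i (ai s)) \<in> class_K" by (rule class_K_compose[OF a1iK aiK])
    ultimately have lim: "((\<lambda>t. a1i (ai (2 / t * a2 s))) \<longlongrightarrow> a1i (ai 0)) at_top"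
      by (intro continuous_on_tendsto_compose[OF class_K_continuous[OF comp]]) auto
    show "(\<psi> s \<longlongrightarrow> 0) at_top"
    proof (rule tendsto_sandwich[OF _ _ tendsto_const])
      show "((\<lambda>t. a1i (ai (2 / t * a2 s))) \<longlongrightarrow> 0) at_top"
        using lim class_K_0[OF comp] by simp
      show "\<forall>\<^sub>F t in at_top. 0 \<le> \<psi> s t" using eventually_ge_at_top[of 0]
        by eventually_elim (simp add: \<psi>_def class_K_nonneg[OF a1iK] \<beta>0_nonneg)
      show "\<forall>\<^sub>F t in at_top. \<psi> s t \<le> a1i (ai (2 / t * a2 s))" using eventually_gt_at_top[of 0]
      proof eventually_elim
        case (elim t)
        then show ?case unfolding \<psi>_def
          by (intro class_K_mono[OF a1iK \<beta>0_nonneg]) (auto simp: \<beta>0_def)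
      qed
    qed
  qed
  define \<phi> where "\<phi> r = a1i (ai (2 * \<rho> r))" for r
  have \<phi>: "\<phi> \<in> class_K" unfolding \<phi>_def
    by (rule class_K_compose[OF a1iK class_K_compose[OF aiK class_K_scale[OF \<rho>K]]]) simp
  have est: "norm (x T) \<le> \<psi> (norm (x 0)) T + \<phi> (L_inf_norm {0<..<T} v)"
    if vx: "(v, x) \<in> B_inc_inf A B C (lure_F \<alpha> \<theta> c \<mu>)" and T: "0 \<le> T" for v x T
  proof -
    define b where "b = L_inf_norm {0<..<T} v"
    have b: "0 \<le> b" by (simp add: b_def L_inf_norm_nonneg)
    obtain N where N: "negligible N" and x: "abs_cont_on {0..T} x"
      and vb: "\<And>t. t \<in> {0..T} - N \<Longrightarrow> norm (v t) \<le> b"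
      and w: "\<And>t. t \<in> {0..T} - N \<Longrightarrow> \<exists>w\<in>lure_F \<alpha> \<theta> c \<mu> (C *v x t).
        (x has_vector_derivative (A *v x t + B *v (v t - w))) (at t within {0..T})"
      unfolding b_def using B_inc_inf_trajectory[OF vx T] by blast
    have "W (x T) \<le> max (if T = 0 then W (x 0) else min (W (x 0)) (ai (2 * W (x 0) / T))) (ai (2 * \<rho> b))"
    proof (rule comparison_nonpos_deriv[where V = "\<lambda>t. W (x t)", OF T _ W0 a ai N class_K_nonneg[OF \<rho>K b]])
      show "abs_cont_on {0..T} (\<lambda>t. W (x t))"
      proof (rule abs_cont_on_dominated[OF abs_cont_on_quadratic[OF x, of P] abs_cont_on_quadratic[OF x, of Q]])
        fix s t
        \<comment> \<open>\<open>h\<close> has derivative in \<open>[0, 1]\<close>, so it is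
          Lipschitz and the composition stays absolutely continuous.\<close>
        have "norm (h (x s \<bullet> (Q *v x s)) - h (x t \<bullet> (Q *v x t))) \<le> 1 * norm (x s \<bullet> (Q *v x s) - x t \<bullet> (Q *v x t))"
        proof (rule field_differentiable_bound[of "{0..}"])
          fix z :: real assume z: "z \<in> {0..}"
          show "(h has_real_derivative \<sigma> z / (1 + sqrt z)) (at z within {0..})" using h(2) z by simp
          have "0 \<le> \<alpha> (k * sqrt z)" using z k by (intro class_K_nonneg[OF \<alpha>K]) auto
          then have "0 \<le> \<sigma> z" "\<sigma> z \<le> 1" by (auto simp: \<sigma>_def)
          moreover have "0 \<le> sqrt z" using z by simp
          ultimately have "0 < 1 + sqrt z" "\<sigma> z \<le> 1 + sqrt z" by linarith+
          then show "norm (\<sigma> z / (1 + sqrt z)) \<le> 1" using \<open>0 \<le> \<sigma> z\<close> by simp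
        qed (auto simp: Q_nonneg)
        moreover have "norm (W (x s) - W (x t)) \<le> norm (\<kappa> * (x s \<bullet> (P *v x s) - x t \<bullet> (P *v x t)))
            + norm (h (x s \<bullet> (Q *v x s)) - h (x t \<bullet> (Q *v x t)))"
        proof -
          have "W (x s) - W (x t) = \<kappa> * (x s \<bullet> (P *v x s) - x t \<bullet> (P *v x t)) + (h (x s \<bullet> (Q *v x s)) - h (x t \<bullet> (Q *v x t)))"
            by (simp add: W_def algebra_simps)
          then show ?thesis by (simp only: norm_triangle_ineq)
        qed
        ultimately show "norm (W (x s) - W (x t)) \<le> \<kappa> * norm (x s \<bullet> (P *v x s) - x t \<bullet> (P *v x t)) + 1 * norm (x s \<bullet> (Q *v x s) - x t \<bullet> (Q *v x t))"
          using \<kappa> by (simp add: abs_mult)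
      qed
      fix t assume t: "t \<in> {0..T} - N"
      obtain w where w': "w \<in> lure_F \<alpha> \<theta> c \<mu> (C *v x t)"
          "(x has_vector_derivative (A *v x t + B *v (v t - w))) (at t within {0..T})"
        using w[OF t] by blast
      define d where "d = A *v x t + B *v (v t - w)"
      define s where "s = x t \<bullet> (Q *v x t)"
      define D where "D = \<kappa> * (2 * ((P *v x t) \<bullet> d)) + \<sigma> s / (1 + sqrt s) * (2 * ((Q *v x t) \<bullet> d))"
      have "((\<lambda>t. h (x t \<bullet> (Q *v x t))) has_real_derivative \<sigma> s / (1 + sqrt s) * (2 * ((Q *v x t) \<bullet> d))) (at t within {0..T})"
        unfolding s_def d_def
      proof (rule DERIV_image_chain[where f = h and g = "\<lambda>t. x t \<bullet> (Q *v x t)", unfolded o_def])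
        \<comment> \<open>The derivative of \<open>h\<close> may be one-sided, at \<open>0\<close>;
          the chain rule asks for it only within the image of the curve, which lies in the
          half-line.\<close>
        show "(h has_real_derivative \<sigma> (x t \<bullet> (Q *v x t)) / (1 + sqrt (x t \<bullet> (Q *v x t)))) (at (x t \<bullet> (Q *v x t)) within (\<lambda>t. x t \<bullet> (Q *v x t)) ` {0..T})"
          using h(2)[OF Q_nonneg] by (rule has_field_derivative_subset) (auto simp: Q_nonneg)
      qed (rule has_real_derivative_quadratic[OF Q w'(2)])
      then have DD: "((\<lambda>t. W (x t)) has_real_derivative D) (at t within {0..T})"
        unfolding W_def D_def d_def by (intro DERIV_add DERIV_cmult has_real_derivative_quadratic P w'(2))
      have "D \<le> \<rho> (norm (v t)) - \<sigma> s / (1 + sqrt s) * ((norm (x t))\<^sup>2 / 2)"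
        using lyapunov_decay[OF \<alpha> \<alpha>i(1,3) c \<mu> L w'(1) d_def]
        by (simp add: D_def s_def \<rho>_def \<sigma>_def \<kappa>_def k_def)
      also have "\<rho> (norm (v t)) \<le> \<rho> b" using vb[OF t] by (intro class_K_mono[OF \<rho>K]) auto
      also have "\<rho> b - \<sigma> s / (1 + sqrt s) * ((norm (x t))\<^sup>2 / 2) \<le> \<rho> b - a (W (x t))"
      proof -
        define X where "X = norm (x t)"
        have X: "0 \<le> X" by (simp add: X_def)
        have "a2i (W (x t)) \<le> X"
          using class_K_mono[OF a2iK W0 W_le[of "x t"]] a2i(3)[OF X] by (simp add: X_def)
        then have "a (W (x t)) \<le> a3 X"
          unfolding a_def using class_K_nonneg[OF a2iK W0] by (intro class_K_mono[OF a3K])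
        also have "a3 X = \<sigma> (q * X\<^sup>2) / (1 + sqrt K * X) * (X\<^sup>2 / 2)" by (simp add: a3_def power2_eq_square)
        also have "\<dots> \<le> \<sigma> s / (1 + sqrt s) * (X\<^sup>2 / 2)"
        proof (intro mult_right_mono frac_le)
          have "0 \<le> k * sqrt (q * X\<^sup>2)" "k * sqrt (q * X\<^sup>2) \<le> k * sqrt s"
            using k q Q_ge[of "x t"] by (auto simp: X_def s_def)
          then show "\<sigma> (q * X\<^sup>2) \<le> \<sigma> s" using class_K_mono[OF \<alpha>K] by (auto simp: \<sigma>_def min.coboundedI2)
          show "0 \<le> \<sigma> s" using k Q_nonneg[of "x t"] class_K_nonneg[OF \<alpha>K, of "k * sqrt s"] by (auto simp: \<sigma>_def s_def)
          have "sqrt s \<le> sqrt (K * X\<^sup>2)" using Q_le[of "x t"] by (simp add: s_def X_def)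
          then show "1 + sqrt s \<le> 1 + sqrt K * X" using X by (simp add: real_sqrt_mult)
          show "0 < 1 + sqrt s" using Q_nonneg[of "x t"] by (simp add: s_def add_pos_nonneg)
        qed simp
        finally show ?thesis by (simp add: X_def)
      qed
      finally show "\<exists>D. ((\<lambda>t. W (x t)) has_real_derivative D) (at t within {0..T}) \<and> D \<le> \<rho> b - a (W (x t))"
        using DD by auto
    qed
    also have "(if T = 0 then W (x 0) else min (W (x 0)) (ai (2 * W (x 0) / T))) \<le> \<beta>0 (norm (x 0)) T"
    proof -
      have "ai (2 * W (x 0) / T) \<le> ai (2 / T * a2 (norm (x 0)))" if "T \<noteq> 0"
        using that T W0[of "x 0"] W_le[of "x 0"] by (intro class_K_mono[OF aiK]) (auto simp: divide_right_mono)
      then show ?thesis using W_le[of "x 0"] by (auto simp: \<beta>0_def min.coboundedI1 min.coboundedI2)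
    qed
    finally have "W (x T) \<le> max (\<beta>0 (norm (x 0)) T) (ai (2 * \<rho> b))" by (simp add: max.mono)
    then have "a1 (norm (x T)) \<le> max (\<beta>0 (norm (x 0)) T) (ai (2 * \<rho> b))" using W_ge[of "x T"] by linarith
    then have "a1i (a1 (norm (x T))) \<le> a1i (max (\<beta>0 (norm (x 0)) T) (ai (2 * \<rho> b)))"
      using class_K_nonneg[OF a1K, of "norm (x T)"] by (intro class_K_mono[OF a1iK]) auto
    also have "\<dots> \<le> \<psi> (norm (x 0)) T + \<phi> b"
    proof -
      have "0 \<le> \<psi> (norm (x 0)) T" "0 \<le> \<phi> b"
        using class_K_nonneg[OF a1iK] class_K_nonneg[OF \<beta>0K[OF T], of "norm (x 0)"] class_K_nonneg[OF \<phi> b] by (auto simp: \<psi>_def)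
      then show ?thesis by (simp add: max_def \<psi>_def \<phi>_def)
    qed
    finally show ?thesis using a1i(3)[of "norm (x T)"] by (simp add: b_def)
  qed
  show ?thesis unfolding ISS_def using \<open>\<psi> \<in> class_KL\<close> \<phi> est by blast
qed

end

section \<open>Supplying the Lyapunov data, and the three statements\<close>

lemma lure_lyapunov_exists:
  fixes A P :: "real^'n^'n" and B :: "real^'m^'n" and C :: "real^'n^'m"
  assumes "detectable C A" and P: "pos_semidef P" and lmi: "loewner_le
      (block_matrix (transpose A ** P + P ** A) (P ** B - transpose C) (transpose B ** P - C) 0) 0"
  obtains Q q K where "lure_lyapunov A P Q B C q K"
proof -
  obtain Q q K where Q: "pos_semidef Q" and q: "0 < q" and K: "0 < K"
    and Q_ge: "\<And>x. q * (norm x)\<^sup>2 \<le> x \<bullet> (Q *v x)" and Q_le: "\<And>x. x \<bullet> (Q *v x) \<le> K * (norm x)\<^sup>2"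
    and Q_deriv: "\<And>x u. 2 * ((Q *v x) \<bullet> (A *v x + u)) \<le> - (norm x)\<^sup>2 + K * norm x * (norm (C *v x) + norm u)"
    using detectable_lyapunov[OF assms(1)] by blast
  obtain p where p: "0 < p" "\<And>z. norm (P *v z) \<le> p * norm z"
    using linear_bounded_pos[OF matrix_vector_mul_linear[of P]] by auto
  obtain b where b: "0 < b" "\<And>z. norm (B *v z) \<le> b * norm z"
    using linear_bounded_pos[OF matrix_vector_mul_linear[of B]] by auto
  \<comment> \<open>\<open>p\<close> accounts for the upper bound on \<open>P\<close>; the factor
    \<open>1 + b\<close> arises from inserting \<open>B *v (v - w)\<close> for the free vector in
    the derivative bound for \<open>Q\<close>.\<close>
  define K' where "K' = p + K * (1 + b)"
  have K': "p \<le> K'" "K \<le> K'" "K * (1 + b) \<le> K'" using p b K by (auto simp: K'_def algebra_simps)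
  have "lure_lyapunov A P Q B C q K'"
  proof
    show "pos_semidef P" "pos_semidef Q" "0 < q" by (fact P Q q)+
    show "0 < K'" using K K'(2) by linarith
    show "(P *v x) \<bullet> (A *v x) \<le> 0" "(P *v x) \<bullet> (B *v u) = u \<bullet> (C *v x)" for x u
      by (rule passivity_lmi[OF P lmi])+
    show "q * (norm x)\<^sup>2 \<le> x \<bullet> (Q *v x)" for x by (rule Q_ge)
    show "x \<bullet> (Q *v x) \<le> K' * (norm x)\<^sup>2" for x
      using Q_le[of x] mult_right_mono[OF K'(2), of "(norm x)\<^sup>2"] by simp
    show "x \<bullet> (P *v x) \<le> K' * (norm x)\<^sup>2" for x
    proof -
      have "x \<bullet> (P *v x) \<le> norm x * (p * norm x)"
        using norm_cauchy_schwarz[of x "P *v x"] mult_left_mono[OF p(2)[of x], of "norm x"] by simp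
      also have "\<dots> \<le> K' * (norm x)\<^sup>2"
        using mult_right_mono[OF K'(1), of "(norm x)\<^sup>2"] by (simp add: power2_eq_square mult_ac)
      finally show ?thesis .
    qed
    fix x :: "real^'n" and v w :: "real^'m"
    have "b * norm (v - w) \<le> b * (norm w + norm v)"
      using norm_triangle_ineq4[of v w] b(1) by (intro mult_left_mono) auto
    then have Bvw: "norm (B *v (v - w)) \<le> b * (norm w + norm v)" using b(2)[of "v - w"] by linarith
    have "norm (C *v x) + norm (B *v (v - w)) \<le> (1 + b) * (norm (C *v x) + norm w + norm v)"
    proof -
      have "0 \<le> norm w + norm v + b * norm (C *v x)" using b(1) by simp
      then have "norm (C *v x) + b * (norm w + norm v) \<le> (1 + b) * (norm (C *v x) + norm w + norm v)"
        by (simp add: algebra_simps)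
      then show ?thesis using Bvw by linarith
    qed
    then have "K * norm x * (norm (C *v x) + norm (B *v (v - w))) \<le> K * norm x * ((1 + b) * (norm (C *v x) + norm w + norm v))"
      using K by (intro mult_left_mono) auto
    also have "\<dots> = K * (1 + b) * (norm x * (norm (C *v x) + norm w + norm v))" by (simp only: mult_ac)
    also have "\<dots> \<le> K' * (norm x * (norm (C *v x) + norm w + norm v))" using K'(3) by (intro mult_right_mono) auto
    finally show "2 * ((Q *v x) \<bullet> (A *v x + B *v (v - w)))
          \<le> - (norm x)\<^sup>2 + K' * norm x * (norm (C *v x) + norm w + norm v)"
      using Q_deriv[of x "B *v (v - w)"] by (simp add: mult.assoc)
  qed
  then show ?thesis by (rule that)
qed

text \<open>The derivative is bounded on the compact interval, including the endpoint
  \<open>0\<close>, so the mean value inequality applies. The radius \<open>r\<close> is free: it is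
  \<open>\<mu>\<close> for ISS and a bound on the outputs for the semiglobal estimate.\<close>

lemma C1_on_half_line_linear_bound:
  assumes "C1_on_half_line f" "f 0 = 0"
  obtains L where "0 < L" "\<And>s. 0 \<le> s \<Longrightarrow> s \<le> r \<Longrightarrow> f s \<le> L * s"
proof -
  obtain f' where f': "continuous_on {0..} f'" "\<And>s. 0 \<le> s \<Longrightarrow> (f has_real_derivative f' s) (at s within {0..})"
    using assms(1) unfolding C1_on_half_line_def by blast
  have "continuous_on {0..r} f'" by (rule continuous_on_subset[OF f'(1)]) auto
  then have "bounded (f' ` {0..r})" by (intro compact_imp_bounded compact_continuous_image) auto
  then obtain L where L: "0 < L" "\<And>s. s \<in> {0..r} \<Longrightarrow> norm (f' s) \<le> L"
    by (auto simp: bounded_pos)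
  show ?thesis
  proof (rule that[OF L(1)])
    fix s assume s: "0 \<le> s" "s \<le> r"
    have "norm (f s - f 0) \<le> L * norm (s - 0)"
    proof (rule field_differentiable_bound[of "{0..r}"])
      show "(f has_real_derivative f' z) (at z within {0..r})" if "z \<in> {0..r}" for z
        using f'(2)[of z] that by (auto intro: has_field_derivative_subset)
    qed (use s L(2) in auto)
    then show "f s \<le> L * s" using assms(2) s by simp
  qed
qed

theorem theorem3p1:
  fixes A :: "real^'n^'n" and B :: "real^'m^'n" and C :: "real^'n^'m"
    and \<alpha> \<theta> :: "real \<Rightarrow> real" and c \<mu> :: real
  assumes "\<theta> \<in> class_K_inf" and "C1_on_half_line \<theta>"
    and "\<alpha> \<in> {0..} \<rightarrow> {0..}" and "\<forall>s\<ge>0. \<alpha> s \<le> \<theta> s"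
    and "c > 0" and "\<mu> > 0" and "c * \<mu> \<ge> 1"
    and "detectable C A"
    and "\<exists>P :: real^'n^'n. pos_semidef P \<and>
           loewner_le
             (block_matrix (transpose A ** P + P ** A) (P ** B - transpose C)
                           (transpose B ** P - C)      0) 0"
  shows "(\<alpha> \<in> class_K_inf \<longrightarrow> ISS A B C (lure_F \<alpha> \<theta> c \<mu>)) \<and>
    (\<alpha> \<in> class_K_inf \<and> (\<exists>\<epsilon>0>0. \<forall>s\<ge>0. \<alpha> s \<ge> \<epsilon>0 * s) \<longrightarrow>
       (\<forall>R>0. \<exists>M>0. \<exists>\<gamma>>0. \<forall>(v, x)\<in>B_inc_inf A B C (lure_F \<alpha> \<theta> c \<mu>).
          v \<in> L_inf {0..} \<and> norm (x 0) + L_inf_norm {0..} v \<le> R \<longrightarrow>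
          (\<forall>t\<ge>0. norm (x t) \<le> M * (exp (- \<gamma> * t) * norm (x 0) + L_inf_norm {0<..<t} v))) \<and>
       ((\<exists>a>0. \<forall>s\<ge>0. \<theta> s \<le> a * s) \<longrightarrow> exponentially_ISS A B C (lure_F \<alpha> \<theta> c \<mu>)))"
proof -
  let ?F = "lure_F \<alpha> \<theta> c \<mu>"
  obtain P :: "real^'n^'n" where P: "pos_semidef P" and lmi: "loewner_le
      (block_matrix (transpose A ** P + P ** A) (P ** B - transpose C) (transpose B ** P - C) 0) 0"
    using assms(9) by blast
  obtain Q q K where "lure_lyapunov A P Q B C q K"
    using lure_lyapunov_exists[OF assms(8) P lmi] by blast
  then interpret lure_lyapunov A P Q B C q K .
  have \<theta>0: "\<theta> 0 = 0" by (rule class_K_0[OF class_K_inf_imp_K[OF assms(1)]])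
  have iss: "ISS A B C ?F" if \<alpha>: "\<alpha> \<in> class_K_inf"
  proof -
    obtain L where L: "0 < L" "\<And>s. 0 \<le> s \<Longrightarrow> s \<le> \<mu> \<Longrightarrow> \<theta> s \<le> L * s"
      using C1_on_half_line_linear_bound[OF assms(2) \<theta>0, of \<mu>] by blast
    show ?thesis by (rule iss[OF \<alpha> assms(5,6) less_imp_le[OF L(1)] L(2)])
  qed
  \<comment> \<open>\<open>S\<close> is the set of output norms on which \<open>\<theta>\<close> has
    a linear bound. Both exponential statements are instances, with a bounded interval and with all
    reals.\<close>
  have sector: "\<exists>M>0. \<exists>\<gamma>>0. \<forall>(v, x)\<in>B_inc_inf A B C ?F. \<forall>t\<ge>0.
      (\<forall>s\<in>{0..t}. norm (C *v x s) \<in> S) \<longrightarrow>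
      norm (x t) \<le> M * (exp (- \<gamma> * t) * norm (x 0) + L_inf_norm {0<..<t} v)"
    if \<epsilon>: "0 < \<epsilon>" "\<forall>s\<ge>0. \<epsilon> * s \<le> \<alpha> s" and L: "0 < L" "\<And>s. s \<in> S \<Longrightarrow> 0 \<le> s \<Longrightarrow> \<theta> s \<le> L * s" for \<epsilon> L S
  proof -
    obtain M \<gamma> where M: "0 < M" "0 < \<gamma>"
      and est: "\<And>v x T N b. \<lbrakk>0 \<le> T; abs_cont_on {0..T} x; negligible N; 0 \<le> b;
        \<And>t. t \<in> {0..T} - N \<Longrightarrow> norm (v t) \<le> b;
        \<And>t. t \<in> {0..T} - N \<Longrightarrow> \<exists>w. norm w \<le> L * norm (C *v x t) \<and> \<epsilon> * (norm (C *v x t))\<^sup>2 \<le> w \<bullet> (C *v x t) \<and>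
          (x has_vector_derivative (A *v x t + B *v (v t - w))) (at t within {0..T})\<rbrakk>
      \<Longrightarrow> norm (x T) \<le> M * (exp (- \<gamma> * T) * norm (x 0) + b)"
      using exponential_estimate[OF \<epsilon>(1) L(1)] by blast
    have "norm (x T) \<le> M * (exp (- \<gamma> * T) * norm (x 0) + L_inf_norm {0<..<T} v)"
      if vx: "(v, x) \<in> B_inc_inf A B C ?F" and T: "0 \<le> T" and S: "\<forall>s\<in>{0..T}. norm (C *v x s) \<in> S" for v x T
    proof -
      obtain N where N: "negligible N" and x: "abs_cont_on {0..T} x"
        and vb: "\<And>t. t \<in> {0..T} - N \<Longrightarrow> norm (v t) \<le> L_inf_norm {0<..<T} v"
        and w: "\<And>t. t \<in> {0..T} - N \<Longrightarrow> \<exists>w\<in>?F (C *v x t).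
          (x has_vector_derivative (A *v x t + B *v (v t - w))) (at t within {0..T})"
        using B_inc_inf_trajectory[OF vx T] by blast
      show ?thesis
      proof (rule est[OF T x N L_inf_norm_nonneg vb])
        fix t assume t: "t \<in> {0..T} - N"
        obtain w where w': "w \<in> ?F (C *v x t)"
          "(x has_vector_derivative (A *v x t + B *v (v t - w))) (at t within {0..T})"
          using w[OF t] by blast
        let ?y = "norm (C *v x t)"
        have "norm w \<le> L * ?y" using w'(1) L(2)[of ?y] S t by (force simp: lure_F_def)
        moreover have "\<epsilon> * ?y\<^sup>2 \<le> w \<bullet> (C *v x t)"
        proof -
          have "?y * (\<epsilon> * ?y) \<le> ?y * \<alpha> ?y" using \<epsilon>(2) by (intro mult_left_mono) auto
          then show ?thesis using w'(1) by (simp add: lure_F_def power2_eq_square mult_ac)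
        qed
        ultimately show "\<exists>w. norm w \<le> L * norm (C *v x t) \<and> \<epsilon> * (norm (C *v x t))\<^sup>2 \<le> w \<bullet> (C *v x t) \<and>
          (x has_vector_derivative (A *v x t + B *v (v t - w))) (at t within {0..T})"
          using w'(2) by blast
      qed
    qed
    then show ?thesis using M by blast
  qed
  have semiglobal: "\<exists>M>0. \<exists>\<gamma>>0. \<forall>(v, x)\<in>B_inc_inf A B C ?F.
          v \<in> L_inf {0..} \<and> norm (x 0) + L_inf_norm {0..} v \<le> R \<longrightarrow>
          (\<forall>t\<ge>0. norm (x t) \<le> M * (exp (- \<gamma> * t) * norm (x 0) + L_inf_norm {0<..<t} v))"
    if \<alpha>: "\<alpha> \<in> class_K_inf" and \<epsilon>: "0 < \<epsilon>" "\<forall>s\<ge>0. \<epsilon> * s \<le> \<alpha> s" and R: "0 < R" for \<epsilon> R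
  proof -
    obtain \<psi> \<phi> where \<psi>: "\<psi> \<in> class_KL" and \<phi>: "\<phi> \<in> class_K"
      and bd: "\<And>v x t. (v, x) \<in> B_inc_inf A B C ?F \<Longrightarrow> 0 \<le> t \<Longrightarrow>
          norm (x t) \<le> \<psi> (norm (x 0)) t + \<phi> (L_inf_norm {0<..<t} v)"
      using iss[OF \<alpha>] unfolding ISS_def by blast
    obtain k where k: "0 < k" "\<And>z. norm (C *v z) \<le> k * norm z"
      using linear_bounded_pos[OF matrix_vector_mul_linear[of C]] by auto
    \<comment> \<open>ISS bounds the state by \<open>\<psi> R 0 + \<phi> R\<close> at all times;
      \<open>r\<close> is the resulting bound on the output. It depends on \<open>R\<close> but not
      on the trajectory, and so do \<open>L\<close>, \<open>M\<close> and \<open>\<gamma>\<close>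
      below.\<close>
    define r where "r = k * (\<psi> R 0 + \<phi> R)"
    obtain L where L: "0 < L" "\<And>s. 0 \<le> s \<Longrightarrow> s \<le> r \<Longrightarrow> \<theta> s \<le> L * s"
      using C1_on_half_line_linear_bound[OF assms(2) \<theta>0, of r] by blast
    have Cr: "norm (C *v x s) \<in> {0..r}"
      if vx: "(v, x) \<in> B_inc_inf A B C ?F" "v \<in> L_inf {0..}" "norm (x 0) + L_inf_norm {0..} v \<le> R" and s: "0 \<le> s" for v x s
    proof -
      have "\<psi> (norm (x 0)) s \<le> \<psi> (norm (x 0)) 0"
        using \<psi> s by (auto simp: class_KL_def monotone_on_def)
      also have "\<dots> \<le> \<psi> R 0"
        using \<psi> vx(3) L_inf_norm_nonneg[of "{0..}" v]
        by (intro class_K_mono[of "\<lambda>s. \<psi> s 0"]) (auto simp: class_KL_def)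
      finally have 1: "\<psi> (norm (x 0)) s \<le> \<psi> R 0" .
      have "L_inf_norm {0<..<s} v \<le> L_inf_norm {0..} v"
        using vx(2) by (rule L_inf_subset(2)) auto
      then have "L_inf_norm {0<..<s} v \<le> R" using vx(3) norm_ge_zero[of "x 0"] by linarith
      then have 2: "\<phi> (L_inf_norm {0<..<s} v) \<le> \<phi> R" by (intro class_K_mono[OF \<phi>] L_inf_norm_nonneg)
      have "norm (C *v x s) \<le> k * norm (x s)" by (rule k(2))
      also have "\<dots> \<le> r" unfolding r_def using bd[OF vx(1) s] 1 2 k(1) by (intro mult_left_mono) auto
      finally show ?thesis by simp
    qed
    obtain M \<gamma> where M: "0 < M" "0 < \<gamma>" "\<forall>(v, x)\<in>B_inc_inf A B C ?F. \<forall>t\<ge>0.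
      (\<forall>s\<in>{0..t}. norm (C *v x s) \<in> {0..r}) \<longrightarrow>
      norm (x t) \<le> M * (exp (- \<gamma> * t) * norm (x 0) + L_inf_norm {0<..<t} v)"
      using sector[OF \<epsilon> L(1), of "{0..r}"] L(2) by auto
    have "norm (x t) \<le> M * (exp (- \<gamma> * t) * norm (x 0) + L_inf_norm {0<..<t} v)"
      if vx: "(v, x) \<in> B_inc_inf A B C ?F" "v \<in> L_inf {0..}" "norm (x 0) + L_inf_norm {0..} v \<le> R" and t: "0 \<le> t" for v x t
    proof -
      have "\<forall>s\<in>{0..t}. norm (C *v x s) \<in> {0..r}" using Cr[OF vx] by auto
      then show ?thesis using M(3) vx(1) t by blast
    qed
    then show ?thesis using M(1,2) by blast
  qed
  have global: "exponentially_ISS A B C ?F"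
    if \<epsilon>: "0 < \<epsilon>" "\<forall>s\<ge>0. \<epsilon> * s \<le> \<alpha> s" and a: "0 < a" "\<forall>s\<ge>0. \<theta> s \<le> a * s" for \<epsilon> a
    \<comment> \<open>With \<open>UNIV\<close> the condition on the outputs is void.\<close>
    using sector[OF \<epsilon> a(1), of UNIV] a(2) unfolding exponentially_ISS_def by simp
  show ?thesis using iss semiglobal global by blast
qed

end
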